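(* Let $q\in(0,3)$ and $\tau\in\{132,321,213\}$. For each $n\in\mathbb{N}$ let $\Pi_n$ be a random permutation in $\mathcal{S}_n(\tau)$ distributed according to $\mathbb{P}_n^{q,\tau}$, i.e. $\mathbb{P}(\Pi_n=\sigma)=q^{\mathrm{fp}(\sigma)}/Z_n(q,\tau)$ for $\sigma\in\mathcal{S}_n(\tau)$, where $Z_n(q,\tau)=\sum_{\sigma\in\mathcal{S}_n(\tau)}q^{\mathrm{fp}(\sigma)}$. Then as $n\to\infty$, $\mathrm{fp}(\Pi_n)$ converges in distribution to a $\mathrm{NegativeBinomial}(2,1-\frac{q}{3})$ random variable.
   Context: $\mathcal{S}_n$ denotes the set of permutations of $\{1,\dots,n\}$, written in one-line notation $\sigma=\sigma_1\cdots\sigma_n$. For $\sigma\in\mathcal{S}_n$, $\mathrm{fp}(\sigma)$ is the number of $i$ with $\sigma_i=i$. For $\tau\in\mathcal{S}_m$ with $2\le m\le n$, $\sigma$ contains the pattern $\tau$ if there are indices $1\le i_1<\cdots<i_m\le n$ such that for all $j,k$, $\sigma_{i_j}<\sigma_{i_k}$ iff $\tau_j<\tau_k$; otherwise $\sigma$ avoids $\tau$ (and if $m>n$ every $\sigma\in\mathcal{S}_n$ avoids $\tau$). $\mathcal{S}_n(\tau)$ is the set of $\sigma\in\mathcal{S}_n$ avoiding $\tau$. For $r\in\mathbb{N}$, $p\in(0,1)$, a $\mathrm{NegativeBinomial}(r,p)$ random variable $N$ has $\mathbb{P}(N=k)=\binom{k+r-1}{k}(1-p)^kp^r$ for $k=0,1,2,\dots$.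 *)

theory Defs
  imports "HOL-Probability.Probability" "HOL-Combinatorics.Permutations"
begin

text \<open>Permutations of {1..n} are functions sigma :: nat => nat with sigma permutes {1..n};
  sigma i is the i-th entry of the one-line notation. Patterns tau are given
  in one-line notation as lists, e.g. [1,3,2] for 132.\<close>

definition fp :: "nat \<Rightarrow> (nat \<Rightarrow> nat) \<Rightarrow> nat" where
  "fp n \<sigma> = card {i \<in> {1..n}. \<sigma> i = i}"

definition contains_pattern :: "nat \<Rightarrow> (nat \<Rightarrow> nat) \<Rightarrow> nat list \<Rightarrow> bool" where
  "contains_pattern n \<sigma> \<tau> \<longleftrightarrow>
     (\<exists>idx :: nat \<Rightarrow> nat. strict_mono_on {1..length \<tau>} idx \<and> idx ` {1..length \<tau>} \<subseteq> {1..n} \<and>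
        (\<forall>j\<in>{1..length \<tau>}. \<forall>k\<in>{1..length \<tau>}.
            \<sigma> (idx j) < \<sigma> (idx k) \<longleftrightarrow> \<tau> ! (j - 1) < \<tau> ! (k - 1)))"

definition avoiders :: "nat \<Rightarrow> nat list \<Rightarrow> (nat \<Rightarrow> nat) set" where
  "avoiders n \<tau> = {\<sigma>. \<sigma> permutes {1..n} \<and> \<not> contains_pattern n \<sigma> \<tau>}"

definition Zfun :: "nat \<Rightarrow> real \<Rightarrow> nat list \<Rightarrow> real" where
  "Zfun n q \<tau> = (\<Sum>\<sigma>\<in>avoiders n \<tau>. q ^ fp n \<sigma>)"

definition Pnq :: "nat \<Rightarrow> real \<Rightarrow> nat list \<Rightarrow> (nat \<Rightarrow> nat) pmf" where
  "Pnq n q \<tau> = embed_pmf (\<lambda>\<sigma>. if \<sigma> \<in> avoiders n \<tau> then q ^ fp n \<sigma> / Zfun n q \<tau> else 0)"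

definition negbin_pmf :: "nat \<Rightarrow> real \<Rightarrow> nat pmf" where
  "negbin_pmf r p = embed_pmf (\<lambda>k. real ((k + r - 1) choose k) * (1 - p) ^ k * p ^ r)"

end

theory Submission
  imports Defs
begin

text \<open>
  The binomial moments of the number of fixed points are ballot numbers for all three patterns:
  \<open>(\<Sum>\<sigma>. fp \<sigma> choose j)\<close> is the coefficient of \<open>x\<^sup>n\<close> in \<open>x\<^sup>j C(x)\<^bsup>j+1\<^esup>\<close>, where \<open>C\<close> is the
  generating function of the Catalan numbers. Indeed, splitting a permutation at its last marked
  fixed point gives a pair of smaller avoiders, with the remaining marks all in one of them. For 321,
  a fixed point \<open>i\<close> splits \<open>\<sigma>\<close> into a direct sum. For 132, the entries at positions \<open>1..k\<close> exceed \<open>i\<close>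
  for some \<open>k\<close>, and \<open>\<sigma>\<close> maps the block \<open>k+1..i-1\<close> to itself; the block can be any avoider, and
  the rest determines \<open>k\<close>. The reverse-complement carries 132 to 213 and preserves fixed points.

  Relative to the Catalan number, the \<open>j\<close>-th moment tends to \<open>(j+1)/2\<^sup>j\<close> and is bounded by this limit.
  Both \<open>Z\<^sub>n(q)\<close> and the number of avoiders with \<open>k\<close> fixed points are linear combinations of the
  moments, so dominated convergence (which requires \<open>\<bar>q - 1\<bar> < 2\<close>) gives the limit of
  every point probability.
\<close>

subsection \<open>Pattern-avoiding bijections between sets of natural numbers\<close>

text \<open>Bijections are extended by the identity, so that \<open>bijs A A\<close> consists of the permutations of \<open>A\<close>.\<close>

definition bijs :: "nat set \<Rightarrow> nat set \<Rightarrow> (nat \<Rightarrow> nat) set" where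
  "bijs A B = {f. bij_betw f A B \<and> (\<forall>x. x \<notin> A \<longrightarrow> f x = x)}"

definition restr :: "(nat \<Rightarrow> nat) \<Rightarrow> nat set \<Rightarrow> nat \<Rightarrow> nat" where
  "restr f A = (\<lambda>x. if x \<in> A then f x else x)"

definition avoids :: "(nat \<Rightarrow> nat \<Rightarrow> nat \<Rightarrow> bool) \<Rightarrow> nat set \<Rightarrow> (nat \<Rightarrow> nat) \<Rightarrow> bool" where
  "avoids R A f \<longleftrightarrow> (\<forall>i\<in>A. \<forall>j\<in>A. \<forall>k\<in>A. i < j \<longrightarrow> j < k \<longrightarrow> \<not> R (f i) (f j) (f k))"

text \<open>Says that \<open>R\<close> sees only the relative order of its arguments. The set
  \<open>S\<close> allows relabelings that increase merely on the values in use.\<close>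

definition order_invariant :: "(nat \<Rightarrow> nat \<Rightarrow> nat \<Rightarrow> bool) \<Rightarrow> bool" where
  "order_invariant R \<longleftrightarrow>
     (\<forall>S \<beta>. strict_mono_on S \<beta> \<longrightarrow> (\<forall>x\<in>S. \<forall>y\<in>S. \<forall>z\<in>S. R (\<beta> x) (\<beta> y) (\<beta> z) = R x y z))"

definition perms_avoiding :: "(nat \<Rightarrow> nat \<Rightarrow> nat \<Rightarrow> bool) \<Rightarrow> nat \<Rightarrow> (nat \<Rightarrow> nat) set" where
  "perms_avoiding R n = {f \<in> bijs {1..n} {1..n}. avoids R {1..n} f}"

definition R132 :: "nat \<Rightarrow> nat \<Rightarrow> nat \<Rightarrow> bool" where
  "R132 a b c \<longleftrightarrow> a < c \<and> c < b"

definition R321 :: "nat \<Rightarrow> nat \<Rightarrow> nat \<Rightarrow> bool" where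
  "R321 a b c \<longleftrightarrow> c < b \<and> b < a"

definition R213 :: "nat \<Rightarrow> nat \<Rightarrow> nat \<Rightarrow> bool" where
  "R213 a b c \<longleftrightarrow> b < a \<and> a < c"

lemma order_invariant_R132: "order_invariant R132"
  and order_invariant_R321: "order_invariant R321"
  by (simp_all add: order_invariant_def R132_def R321_def strict_mono_on_less)

lemma bijsD:
  assumes "f \<in> bijs A B"
  shows "bij_betw f A B" "inj_on f A" "f ` A = B" "\<And>x. x \<in> A \<Longrightarrow> f x \<in> B" "\<And>x. x \<notin> A \<Longrightarrow> f x = x"
  using assms by (auto simp: bijs_def bij_betw_def)

lemma bijs_eq_permutes: "bijs A A = {f. f permutes A}"
  unfolding bijs_def by (auto intro: bij_imp_permutes permutes_imp_bij simp: permutes_not_in)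

lemma finite_bijs [simp]:
  assumes "finite A" "finite B"
  shows "finite (bijs A B)"
proof (rule finite_subset)
  show "bijs A B \<subseteq> (\<lambda>g. restr g A) ` (A \<rightarrow>\<^sub>E B)"
  proof
    fix f assume f: "f \<in> bijs A B"
    then have "f = restr (restrict f A) A" "restrict f A \<in> A \<rightarrow>\<^sub>E B"
      by (simp_all add: restr_def fun_eq_iff bijsD(4,5) PiE_iff)
    then show "f \<in> (\<lambda>g. restr g A) ` (A \<rightarrow>\<^sub>E B)" by blast
  qed
qed (use assms in \<open>simp add: finite_PiE\<close>)

lemma restr_apply [simp]: "x \<in> A \<Longrightarrow> restr f A x = f x" "x \<notin> A \<Longrightarrow> restr f A x = x"
  by (simp_all add: restr_def)

lemma avoids_cong:
  assumes "\<And>x. x \<in> A \<Longrightarrow> f x = g x"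
  shows "avoids R A f = avoids R A g"
  using assms by (simp add: avoids_def)

lemma avoids_restr [simp]: "avoids R A (restr f A) = avoids R A f"
  by (rule avoids_cong) simp

lemma avoids_subset: "avoids R A f \<Longrightarrow> B \<subseteq> A \<Longrightarrow> avoids R B f"
  unfolding avoids_def by (meson subsetD)

lemma bijsI:
  assumes "inj_on f A" "f ` A = B" "\<And>x. x \<notin> A \<Longrightarrow> f x = x"
  shows "f \<in> bijs A B"
  using assms by (simp add: bijs_def bij_betw_def)

section \<open>Cutting a bijection into two blocks and a point\<close>

text \<open>Once \<open>a\<close> and \<open>A1\<close> have used up \<open>b\<close> and
  \<open>B1\<close>, injectivity leaves exactly \<open>B2\<close> as the image of \<open>A2\<close>.
  Conversely, any two pieces glue together, with \<open>a\<close> sent to \<open>b\<close>.\<close>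

lemma bij_betw_bijs_split:
  assumes "A1 \<inter> A2 = {}" "a \<notin> A1 \<union> A2" "B1 \<inter> B2 = {}" "b \<notin> B1 \<union> B2"
  shows "bij_betw (\<lambda>f. (restr f A1, restr f A2))
           {f \<in> bijs (insert a (A1 \<union> A2)) (insert b (B1 \<union> B2)). f a = b \<and> f ` A1 = B1}
           (bijs A1 B1 \<times> bijs A2 B2)"
proof (rule bij_betw_byWitness[where f' = "\<lambda>(g, h) x. if x = a then b else if x \<in> A1 then g x else h x"])
  show "\<forall>f\<in>{f \<in> bijs (insert a (A1 \<union> A2)) (insert b (B1 \<union> B2)). f a = b \<and> f ` A1 = B1}.
      (case (restr f A1, restr f A2) of (g, h) \<Rightarrow> \<lambda>x. if x = a then b else if x \<in> A1 then g x else h x) = f"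
    by (auto simp: fun_eq_iff restr_def bijsD(5))
  show "\<forall>p\<in>bijs A1 B1 \<times> bijs A2 B2.
      (restr (case p of (g, h) \<Rightarrow> \<lambda>x. if x = a then b else if x \<in> A1 then g x else h x) A1,
       restr (case p of (g, h) \<Rightarrow> \<lambda>x. if x = a then b else if x \<in> A1 then g x else h x) A2) = p"
    using assms by (auto simp: fun_eq_iff restr_def bijsD(5))
  show "(\<lambda>f. (restr f A1, restr f A2)) `
      {f \<in> bijs (insert a (A1 \<union> A2)) (insert b (B1 \<union> B2)). f a = b \<and> f ` A1 = B1} \<subseteq> bijs A1 B1 \<times> bijs A2 B2"
  proof (rule image_subsetI)
    fix f assume "f \<in> {f \<in> bijs (insert a (A1 \<union> A2)) (insert b (B1 \<union> B2)). f a = b \<and> f ` A1 = B1}"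
    then have f: "f \<in> bijs (insert a (A1 \<union> A2)) (insert b (B1 \<union> B2))" "f a = b" "f ` A1 = B1"
      by simp_all
    note inj = bijsD(2)[OF f(1)] and im = bijsD(3)[OF f(1)]
    have "f ` A2 = f ` (insert a (A1 \<union> A2) - insert a A1)"
      using assms by (intro arg_cong[where f = "image f"]) blast
    also have "\<dots> = f ` insert a (A1 \<union> A2) - f ` insert a A1"
      by (rule inj_on_image_set_diff[OF inj]) auto
    also have "\<dots> = B2"
      unfolding im using assms f(2,3) by auto
    finally have "f ` A2 = B2" .
    moreover have "inj_on f A1" "inj_on f A2"
      using inj by (auto intro: inj_on_subset)
    ultimately show "(restr f A1, restr f A2) \<in> bijs A1 B1 \<times> bijs A2 B2"
      using f(3) by (auto intro!: bijsI cong: image_cong inj_on_cong)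
  qed
  show "(\<lambda>(g, h) x. if x = a then b else if x \<in> A1 then g x else h x) ` (bijs A1 B1 \<times> bijs A2 B2)
      \<subseteq> {f \<in> bijs (insert a (A1 \<union> A2)) (insert b (B1 \<union> B2)). f a = b \<and> f ` A1 = B1}"
  proof clarify
    fix g h assume g: "g \<in> bijs A1 B1" and h: "h \<in> bijs A2 B2"
    define f where "f = (\<lambda>x. if x = a then b else if x \<in> A1 then g x else h x)"
    have 1: "f a = b" "\<And>x. x \<in> A1 \<Longrightarrow> f x = g x" "\<And>x. x \<in> A2 \<Longrightarrow> f x = h x"
      using assms by (auto simp: f_def)
    have A1: "bij_betw f A1 B1" and A2: "bij_betw f A2 B2"
      using bijsD(1)[OF g] bijsD(1)[OF h] 1 by (simp_all cong: bij_betw_cong)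
    have "bij_betw f (A1 \<union> A2) (B1 \<union> B2)"
      by (rule bij_betw_combine[OF A1 A2]) (use assms in auto)
    then have "bij_betw f (insert a (A1 \<union> A2)) (insert b (B1 \<union> B2))"
      using assms 1(1) notIn_Un_bij_betw[of a "A1 \<union> A2" f "B1 \<union> B2"] by simp
    moreover have "\<forall>x. x \<notin> insert a (A1 \<union> A2) \<longrightarrow> f x = x"
      using bijsD(5)[OF h] by (auto simp: f_def)
    ultimately show "f \<in> bijs (insert a (A1 \<union> A2)) (insert b (B1 \<union> B2)) \<and> f a = b \<and> f ` A1 = B1"
      using 1(1) A1 by (simp add: bijs_def bij_betw_def)
  qed
qed

text \<open>The weight \<open>G\<close> reads only the block \<open>A1\<close>, so the sum over
  pairs of pieces factors. The equivalence for \<open>P\<close> is assumed only for bijections that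
  respect the cut, where occurrences straddling the blocks can be controlled.\<close>

lemma sum_bijs_split:
  fixes G :: "(nat \<Rightarrow> nat) \<Rightarrow> nat"
  assumes disj: "A1 \<inter> A2 = {}" "a \<notin> A1 \<union> A2" "B1 \<inter> B2 = {}" "b \<notin> B1 \<union> B2"
    and A: "A = insert a (A1 \<union> A2)" and B: "B = insert b (B1 \<union> B2)"
    and P: "\<And>f. f \<in> bijs A B \<Longrightarrow> f a = b \<Longrightarrow> f ` A1 = B1 \<Longrightarrow> P f \<longleftrightarrow> P1 f \<and> P2 f"
    and restr: "\<And>f. P1 (restr f A1) = P1 f" "\<And>f. P2 (restr f A2) = P2 f" "\<And>f. G (restr f A1) = G f"
  shows "(\<Sum>f | f \<in> bijs A B \<and> f a = b \<and> f ` A1 = B1 \<and> P f. G f) =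
           (\<Sum>f | f \<in> bijs A1 B1 \<and> P1 f. G f) * card {f \<in> bijs A2 B2. P2 f}"
proof -
  let ?X = "{f \<in> bijs A B. f a = b \<and> f ` A1 = B1}"
  let ?r = "\<lambda>f. (restr f A1, restr f A2)"
  let ?Y1 = "{f \<in> bijs A1 B1. P1 f}" and ?Y2 = "{f \<in> bijs A2 B2. P2 f}"
  have bij: "bij_betw ?r ?X (bijs A1 B1 \<times> bijs A2 B2)"
    unfolding A B by (rule bij_betw_bijs_split[OF disj])
  have "?r ` {f \<in> ?X. P f} = {p \<in> ?r ` ?X. P1 (fst p) \<and> P2 (snd p)}"
    using P restr by auto
  also have "\<dots> = ?Y1 \<times> ?Y2"
    using bij_betw_imp_surj_on[OF bij] by auto
  finally have "bij_betw ?r {f \<in> ?X. P f} (?Y1 \<times> ?Y2)"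
    using bij_betw_imp_inj_on[OF bij] by (auto simp: bij_betw_def intro: inj_on_subset)
  then have "(\<Sum>f\<in>{f \<in> ?X. P f}. G (fst (?r f))) = (\<Sum>p\<in>?Y1 \<times> ?Y2. G (fst p))"
    by (rule sum.reindex_bij_betw)
  also have "\<dots> = (\<Sum>f\<in>?Y1. \<Sum>h\<in>?Y2. G f)"
    by (simp only: sum.cartesian_product case_prod_unfold)
  also have "\<dots> = (\<Sum>f\<in>?Y1. G f) * card ?Y2"
    by (simp add: sum_distrib_left mult.commute)
  finally show ?thesis
    using restr by (simp add: conj_ac)
qed

section \<open>Relabeling positions and values\<close>

text \<open>Composition with the two relabelings is a bijection between the index sets. The
  relabelings need not be monotone, so shifts, gap-closing maps and the reversal are all
  instances.\<close>

lemma sum_bijs_transfer: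
  fixes G :: "(nat \<Rightarrow> nat) \<Rightarrow> nat"
  assumes \<alpha>: "bij_betw \<alpha> A' A" and \<beta>: "bij_betw \<beta> B' B"
    and P: "\<And>f g. f \<in> bijs A B \<Longrightarrow> g \<in> bijs A' B' \<Longrightarrow> (\<And>x. x \<in> A' \<Longrightarrow> f (\<alpha> x) = \<beta> (g x)) \<Longrightarrow> P f \<longleftrightarrow> P' g"
    and G: "\<And>f g. f \<in> bijs A B \<Longrightarrow> g \<in> bijs A' B' \<Longrightarrow> (\<And>x. x \<in> A' \<Longrightarrow> f (\<alpha> x) = \<beta> (g x)) \<Longrightarrow> G f = G' g"
  shows "(\<Sum>f | f \<in> bijs A B \<and> P f. G f) = (\<Sum>g | g \<in> bijs A' B' \<and> P' g. G' g)"
proof -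
  let ?F = "\<lambda>g. restr (\<beta> \<circ> g \<circ> inv_into A' \<alpha>) A"
  let ?H = "\<lambda>f. restr (inv_into B' \<beta> \<circ> f \<circ> \<alpha>) A'"
  have F: "?F g \<in> bijs A B" "\<And>x. x \<in> A' \<Longrightarrow> ?F g (\<alpha> x) = \<beta> (g x)" if g: "g \<in> bijs A' B'" for g
  proof -
    have "bij_betw (\<beta> \<circ> g \<circ> inv_into A' \<alpha>) A B"
      by (intro bij_betw_trans[OF bij_betw_inv_into[OF \<alpha>]] bij_betw_trans[OF bijsD(1)[OF g] \<beta>])
    then show "?F g \<in> bijs A B"
      by (simp add: bijs_def cong: bij_betw_cong)
    show "?F g (\<alpha> x) = \<beta> (g x)" if "x \<in> A'" for x
      using that \<alpha> by (simp add: bij_betw_inv_into_left bij_betwE)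
  qed
  have H: "?H f \<in> bijs A' B'" if f: "f \<in> bijs A B" for f
  proof -
    have "bij_betw (inv_into B' \<beta> \<circ> f \<circ> \<alpha>) A' B'"
      by (intro bij_betw_trans[OF \<alpha>] bij_betw_trans[OF bijsD(1)[OF f] bij_betw_inv_into[OF \<beta>]])
    then show ?thesis
      by (simp add: bijs_def cong: bij_betw_cong)
  qed
  have HF: "?H (?F g) = g" if g: "g \<in> bijs A' B'" for g
  proof
    fix x show "?H (?F g) x = g x"
      using F(2)[OF g] bijsD(4,5)[OF g] \<beta>
      by (cases "x \<in> A'") (simp_all add: bij_betw_inv_into_left)
  qed
  have FH: "?F (?H f) = f" if f: "f \<in> bijs A B" for f
  proof
    fix x show "?F (?H f) x = f x"
    proof (cases "x \<in> A")
      case True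
      then have "inv_into A' \<alpha> x \<in> A'"
        using \<alpha> by (metis bij_betw_def inv_into_into)
      then show ?thesis
        using True bijsD(4)[OF f True] \<alpha> \<beta>
        by (simp add: bij_betw_inv_into_right)
    qed (simp add: bijsD(5)[OF f])
  qed
  show ?thesis
  proof (rule sum.reindex_bij_witness[of _ ?F ?H])
    fix f assume f: "f \<in> {f. f \<in> bijs A B \<and> P f}"
    then have f': "f \<in> bijs A B" by simp
    have comp: "f (\<alpha> x) = \<beta> (?H f x)" if "x \<in> A'" for x
      using F(2)[OF H[OF f'] that] FH[OF f'] by simp
    show "?F (?H f) = f" by (rule FH[OF f'])
    show "?H f \<in> {g. g \<in> bijs A' B' \<and> P' g}"
      using P[OF f' H[OF f'] comp] H[OF f'] f by simp
    show "G' (?H f) = G f"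
      using G[OF f' H[OF f'] comp] by simp
  next
    fix g assume g: "g \<in> {g. g \<in> bijs A' B' \<and> P' g}"
    then have g': "g \<in> bijs A' B'" by simp
    show "?H (?F g) = g" by (rule HF[OF g'])
    show "?F g \<in> {f. f \<in> bijs A B \<and> P f}"
      using P[OF F(1)[OF g'] g' F(2)[OF g']] F(1)[OF g'] g by blast
  qed
qed

lemma card_bijs_transfer:
  assumes "bij_betw \<alpha> A' A" "bij_betw \<beta> B' B"
    and "\<And>f g. f \<in> bijs A B \<Longrightarrow> g \<in> bijs A' B' \<Longrightarrow> (\<And>x. x \<in> A' \<Longrightarrow> f (\<alpha> x) = \<beta> (g x)) \<Longrightarrow> P f \<longleftrightarrow> P' g"
  shows "card {f \<in> bijs A B. P f} = card {g \<in> bijs A' B'. P' g}"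
  using sum_bijs_transfer[where G = "\<lambda>_. 1" and G' = "\<lambda>_. 1", OF assms] by simp

text \<open>An increasing \<open>\<alpha>\<close> keeps the order of positions, and an increasing
  \<open>\<beta>\<close> keeps the relation between values, so occurrences of the pattern
  correspond.\<close>

lemma avoids_transfer:
  assumes R: "order_invariant R" and \<alpha>: "bij_betw \<alpha> A' A" "strict_mono_on A' \<alpha>"
    and \<beta>: "strict_mono_on B' \<beta>" and g: "g ` A' \<subseteq> B'"
    and comp: "\<And>x. x \<in> A' \<Longrightarrow> f (\<alpha> x) = \<beta> (g x)"
  shows "avoids R A f \<longleftrightarrow> avoids R A' g"
proof -
  have A: "A = \<alpha> ` A'" using \<alpha> by (simp add: bij_betw_def)
  show ?thesis
    unfolding A avoids_def
    using R[unfolded order_invariant_def, rule_format, OF \<beta>] g comp \<alpha>(2)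
    by (auto simp: strict_mono_on_less image_subset_iff)
qed

lemma card_avoids_shift:
  assumes R: "order_invariant R"
  shows "card {f \<in> bijs {a+1..a+n} {b+1..b+n}. avoids R {a+1..a+n} f} = card (perms_avoiding R n)"
  unfolding perms_avoiding_def
proof (rule card_bijs_transfer[where \<alpha> = "\<lambda>x. x + a" and \<beta> = "\<lambda>x. x + b"])
  show \<alpha>: "bij_betw (\<lambda>x. x + a) {1..n} {a+1..a+n}" "bij_betw (\<lambda>x. x + b) {1..n} {b+1..b+n}"
    by (simp_all add: bij_betw_def add.commute)
  fix f g assume "g \<in> bijs {1..n} {1..n}" "\<And>x. x \<in> {1..n} \<Longrightarrow> f (x + a) = g x + b"
  then show "avoids R {a+1..a+n} f \<longleftrightarrow> avoids R {1..n} g"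
    by (intro avoids_transfer[OF R \<alpha>(1), where \<beta> = "\<lambda>x. x + b" and B' = "{1..n}"])
       (auto simp: strict_mono_on_def dest: bijsD)
qed

subsection \<open>Binomial moments of the number of fixed points\<close>

text \<open>Groups the sum by the unique position at which the value \<open>b\<close> is
  taken.\<close>

lemma sum_bijs_by_preimage:
  fixes G :: "(nat \<Rightarrow> nat) \<Rightarrow> nat"
  assumes "finite A" "finite B" "X \<subseteq> bijs A B" "b \<in> B"
  shows "sum G X = (\<Sum>a\<in>A. sum G {f \<in> X. f a = b})"
proof -
  have *: "inv_into A f b \<in> A" "inv_into A f b = a \<longleftrightarrow> f a = b" if "f \<in> X" "a \<in> A" for f a
  proof -
    have f: "inj_on f A" "f ` A = B" using that(1) assms(3) bijsD(2,3) by blast+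
    show "inv_into A f b \<in> A" using f(2) assms(4) by (simp add: inv_into_into)
    show "inv_into A f b = a \<longleftrightarrow> f a = b"
      using f assms(4) that(2) by (metis f_inv_into_f inv_into_f_f)
  qed
  \<comment> \<open>The fact \<open>*\<close> needs an element of \<open>A\<close>. If
    \<open>A\<close> is empty, then a bijection onto \<open>B\<close> cannot take the value
    \<open>b\<close>, so \<open>X\<close> is empty as well.\<close>
  have "A \<noteq> {} \<or> X = {}" using assms(3,4) bijsD(3) by fastforce
  then have "(\<lambda>f. inv_into A f b) ` X \<subseteq> A" using *(1) by blast
  then have "(\<Sum>a\<in>A. sum G {f \<in> X. inv_into A f b = a}) = sum G X"
    using assms by (intro sum.group) (auto intro: finite_subset[OF _ finite_bijs])
  moreover have "{f \<in> X. inv_into A f b = a} = {f \<in> X. f a = b}" if "a \<in> A" for a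
    using *(2)[OF _ that] by blast
  ultimately show ?thesis by simp
qed

lemma sum_bijs_by_value:
  fixes G :: "(nat \<Rightarrow> nat) \<Rightarrow> nat"
  assumes "finite A" "finite B" "X \<subseteq> bijs A B" "a \<in> A"
  shows "sum G X = (\<Sum>b\<in>B. sum G {f \<in> X. f a = b})"
proof (rule sum.group[symmetric])
  show "finite X" using assms finite_subset finite_bijs by blast
  show "(\<lambda>f. f a) ` X \<subseteq> B" using assms bijsD(4) by blast
qed (use assms in simp)

text \<open>A subset of size \<open>j + 1\<close> is its maximum \<open>i\<close> together with
  \<open>j\<close> elements below \<open>i\<close>.\<close>

lemma binomial_Suc_eq_sum:
  fixes F :: "nat set"
  assumes "finite F"
  shows "(\<Sum>i\<in>F. card {x \<in> F. x < i} choose j) = card F choose Suc j"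
  using assms
proof (induction F rule: finite_linorder_max_induct)
  case (insert b F)
  have "{x \<in> insert b F. x < b} = F" using insert by auto
  moreover have "{x \<in> insert b F. x < i} = {x \<in> F. x < i}" if "i \<in> F" for i
    using insert that by auto
  moreover have "b \<notin> F" using insert by auto
  ultimately show ?case using insert by simp
qed simp

text \<open>Pattern avoidance makes certain sets of positions or values initial or final segments;
  counting their elements then pins them down.\<close>

lemma down_closed_eq_atLeastAtMost:
  fixes D :: "nat set"
  assumes "D \<subseteq> {1..N}" and down: "\<And>x y. y \<in> D \<Longrightarrow> 1 \<le> x \<Longrightarrow> x < y \<Longrightarrow> x \<in> D"
  shows "D = {1..card D}"
proof (cases "D = {}")
  case False
  have fin: "finite D" using assms(1) finite_subset by blast
  define m where "m = Max D"
  have "D = {1..m}"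
    unfolding m_def
  proof
    show "D \<subseteq> {1..Max D}" using assms(1) fin by auto
    show "{1..Max D} \<subseteq> D"
    proof
      fix x assume "x \<in> {1..Max D}"
      then show "x \<in> D"
        using down[OF Max_in[OF fin False], of x] Max_in[OF fin False] by (cases "x = Max D") auto
    qed
  qed
  then have "card D = m" by simp
  with \<open>D = {1..m}\<close> show ?thesis by metis
qed simp

lemma up_closed_eq_atLeastAtMost:
  fixes D :: "nat set"
  assumes "D \<subseteq> {1..N}" and up: "\<And>x y. x \<in> D \<Longrightarrow> x < y \<Longrightarrow> y \<le> N \<Longrightarrow> y \<in> D"
  shows "D = {Suc (N - card D)..N}"
proof -
  have "{1..N} - D = {1..card ({1..N} - D)}"
  proof (rule down_closed_eq_atLeastAtMost)
    fix x y assume "y \<in> {1..N} - D" "1 \<le> x" "x < y"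
    then show "x \<in> {1..N} - D" using up[of x y] by auto
  qed auto
  moreover have "card ({1..N} - D) = N - card D"
    using assms(1) by (subst card_Diff_subset) (auto intro: finite_subset)
  ultimately have "{1..N} - D = {1..N - card D}" by simp
  then have "D = {1..N} - {1..N - card D}" using assms(1) by (metis double_diff subset_refl)
  also have "\<dots> = {Suc (N - card D)..N}" by auto
  finally show ?thesis .
qed

definition fp_moment :: "(nat \<Rightarrow> nat \<Rightarrow> nat \<Rightarrow> bool) \<Rightarrow> nat \<Rightarrow> nat \<Rightarrow> nat" where
  "fp_moment R n j = (\<Sum>f\<in>perms_avoiding R n. fp n f choose j)"

lemma perms_avoiding_subset: "perms_avoiding R n \<subseteq> bijs {1..n} {1..n}"
  by (auto simp: perms_avoiding_def)

lemma finite_perms_avoiding [simp]: "finite (perms_avoiding R n)"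
  by (rule finite_subset[OF perms_avoiding_subset]) simp

text \<open>The moment counts avoiders with \<open>j + 1\<close> marked fixed points. Here
  \<open>i\<close> is the last mark, and the other \<open>j\<close> are chosen among the fixed
  points below it.\<close>

lemma fp_moment_Suc:
  "fp_moment R n (Suc j) =
     (\<Sum>i\<in>{1..n}. \<Sum>f | f \<in> perms_avoiding R n \<and> f i = i. card {x \<in> {1..<i}. f x = x} choose j)"
proof -
  have "fp_moment R n (Suc j) =
      (\<Sum>f\<in>perms_avoiding R n. \<Sum>i | i \<in> {1..n} \<and> f i = i. card {x \<in> {1..<i}. f x = x} choose j)"
    unfolding fp_moment_def
  proof (rule sum.cong)
    fix f
    have "{x \<in> {i \<in> {1..n}. f i = i}. x < i} = {x \<in> {1..<i}. f x = x}" if "i \<in> {1..n}" for i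
      using that by auto
    then show "fp n f choose Suc j = (\<Sum>i | i \<in> {1..n} \<and> f i = i. card {x \<in> {1..<i}. f x = x} choose j)"
      unfolding fp_def by (subst binomial_Suc_eq_sum[symmetric]) (auto intro!: sum.cong)
  qed simp
  also have "\<dots> = (\<Sum>i\<in>{1..n}. \<Sum>f | f \<in> perms_avoiding R n \<and> f i = i. card {x \<in> {1..<i}. f x = x} choose j)"
    by (rule sum.swap_restrict) simp_all
  finally show ?thesis .
qed

text \<open>Pigeonhole: if no position beyond \<open>i\<close> had a value below \<open>i\<close>,
  then \<open>f\<close> would map \<open>{i..n}\<close> onto itself, leaving no room there for the
  value \<open>f x\<close>.\<close>

lemma bijs_crossing:
  assumes f: "f \<in> bijs {1..n} {1..n}" and i: "f i = i" "i \<in> {1..n}" and x: "x \<in> {1..n}" "x < i" "i < f x"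
  shows "\<exists>z\<in>{1..n}. i < z \<and> f z < i"
proof (rule ccontr)
  assume *: "\<not> ?thesis"
  have "f ` {i..n} \<subseteq> {i..n}"
  proof
    fix w assume "w \<in> f ` {i..n}"
    then obtain z where z: "z \<in> {i..n}" "w = f z" by blast
    then have "z \<in> {1..n}" using i by auto
    then have "f z \<in> {1..n}" "z \<noteq> i \<longrightarrow> \<not> f z < i" using bijsD(4)[OF f, of z] * z by auto
    then show "w \<in> {i..n}" using z i by (cases "z = i") auto
  qed
  moreover have inj: "inj_on f {i..n}"
    using bijsD(2)[OF f] by (rule inj_on_subset) (use i in auto)
  ultimately have "f ` {i..n} = {i..n}" by (rule endo_inj_surj[rotated]) simp
  moreover have "f x \<in> {i..n}" using bijsD(4)[OF f x(1)] x by auto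
  ultimately obtain z where "z \<in> {i..n}" "f z = f x" by (metis imageE)
  then show False
    using inj_onD[OF bijsD(2)[OF f], of z x] x i by auto
qed

section \<open>Fixed points of 321-avoiding permutations\<close>

text \<open>An entry that jumps over \<open>i\<close> from the left forces one that jumps back from
  the right; with the fixed point in the middle they form a 321.\<close>

lemma R321_below_fixed_point:
  assumes f: "f \<in> bijs {1..n} {1..n}" and i: "f i = i" "i \<in> {1..n}" and av: "avoids R321 {1..n} f"
  shows "f ` {1..<i} = {1..<i}"
proof -
  have inj: "inj_on f {1..<i}"
    using bijsD(2)[OF f] by (rule inj_on_subset) (use i in auto)
  have "f x < i" if "x \<in> {1..<i}" for x
  proof (rule ccontr)
    have x: "x \<in> {1..n}" "x < i" using that i(2) by auto
    assume "\<not> f x < i"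
    moreover have "f x \<noteq> i" using inj_onD[OF bijsD(2)[OF f], of x i] that i by auto
    ultimately have "i < f x" by simp
    then obtain z where "z \<in> {1..n}" "i < z" "f z < i"
      using bijs_crossing[OF f i x] \<open>i < f x\<close> by auto
    then have "\<not> R321 (f x) (f i) (f z)"
      using av x i(2) unfolding avoids_def by blast
    then show False
      using \<open>i < f x\<close> \<open>f z < i\<close> i(1) by (simp add: R321_def)
  qed
  then have "f ` {1..<i} \<subseteq> {1..<i}"
    using bijsD(4)[OF f] i by force
  then show ?thesis by (rule endo_inj_surj[OF _ _ inj, rotated]) simp
qed

text \<open>The last marked fixed point \<open>i\<close> cuts the permutation into a direct sum. The
  other marks lie in the left summand, and the right one is an arbitrary avoider.\<close>

lemma fp_moment_R321_Suc:
  "fp_moment R321 n (Suc j) = (\<Sum>i\<in>{1..n}. fp_moment R321 (i - 1) j * card (perms_avoiding R321 (n - i)))"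
  unfolding fp_moment_Suc
proof (rule sum.cong)
  fix i assume i: "i \<in> {1..n}"
  let ?G = "\<lambda>f. card {x \<in> {1..<i}. f x = x} choose j"
  have "{f. f \<in> perms_avoiding R321 n \<and> f i = i} =
      {f. f \<in> bijs {1..n} {1..n} \<and> f i = i \<and> f ` {1..<i} = {1..<i} \<and> avoids R321 {1..n} f}"
    unfolding perms_avoiding_def using R321_below_fixed_point[OF _ _ i] by blast
  then have "sum ?G {f. f \<in> perms_avoiding R321 n \<and> f i = i} =
      (\<Sum>f | f \<in> bijs {1..n} {1..n} \<and> f i = i \<and> f ` {1..<i} = {1..<i} \<and> avoids R321 {1..n} f. ?G f)"
    by simp
  also have "\<dots> = (\<Sum>f | f \<in> bijs {1..<i} {1..<i} \<and> avoids R321 {1..<i} f. ?G f) *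
      card {f \<in> bijs {i+1..n} {i+1..n}. avoids R321 {i+1..n} f}"
  proof (rule sum_bijs_split)
    fix f assume f: "f \<in> bijs {1..n} {1..n}" "f i = i" "f ` {1..<i} = {1..<i}"
    have lt: "f x < i" if "x \<in> {1..<i}" for x using f(3) that by (metis atLeastLessThan_iff imageI)
    have gt: "f x > i" if "x \<in> {i+1..n}" for x
    proof (rule ccontr)
      assume "\<not> i < f x"
      then have "f x \<in> insert i {1..<i}" using bijsD(4)[OF f(1), of x] that by auto
      then have "f x \<in> f ` insert i {1..<i}" using f by auto
      then obtain y where "y \<in> insert i {1..<i}" "f y = f x" by (metis imageE)
      then show False using inj_onD[OF bijsD(2)[OF f(1)], of y x] that i by auto
    qed
    show "avoids R321 {1..n} f \<longleftrightarrow> avoids R321 {1..<i} f \<and> avoids R321 {i+1..n} f"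
    proof safe
      assume 1: "avoids R321 {1..<i} f" and 2: "avoids R321 {i+1..n} f"
      show "avoids R321 {1..n} f"
        unfolding avoids_def
      proof (intro ballI impI notI)
        fix x y z assume *: "x \<in> {1..n}" "y \<in> {1..n}" "z \<in> {1..n}" "x < y" "y < z" "R321 (f x) (f y) (f z)"
        then have dec: "f z < f y" "f y < f x" by (auto simp: R321_def)
        \<comment> \<open>Values left of \<open>i\<close> are smaller than \<open>i\<close> and
          values right of it are larger, so a decreasing triple stays strictly on one side.\<close>
        consider "x < i" "z < i" | "x < i" "z = i" | "x < i" "i < z" | "x = i" | "x > i" by linarith
        then show False
        proof cases
          case 1
          then show False using \<open>avoids R321 {1..<i} f\<close> * unfolding avoids_def by auto
        next
          case 2
          then show False using lt[of x] * dec f(2) by auto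
        next
          case 3
          then show False using lt[of x] gt[of z] * dec f(2) by auto
        next
          case 4
          then show False using gt[of z] * dec f(2) by auto
        next
          case 5
          then show False using 2 * unfolding avoids_def by auto
        qed
      qed
    qed (erule avoids_subset, use i in auto)+
  qed (use i in \<open>auto cong: conj_cong\<close>)
  also have "(\<Sum>f | f \<in> bijs {1..<i} {1..<i} \<and> avoids R321 {1..<i} f. ?G f) = fp_moment R321 (i - 1) j"
  proof -
    have "{1..<i} = {1..i - 1}" using i by auto
    then show ?thesis by (simp add: fp_moment_def perms_avoiding_def fp_def)
  qed
  also have "card {f \<in> bijs {i+1..n} {i+1..n}. avoids R321 {i+1..n} f} = card (perms_avoiding R321 (n - i))"
    using card_avoids_shift[OF order_invariant_R321, of i "n - i" i] i by simp
  finally show "sum ?G {f. f \<in> perms_avoiding R321 n \<and> f i = i} =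
      fp_moment R321 (i - 1) j * card (perms_avoiding R321 (n - i))" .
qed simp

subsection \<open>Counting 321-avoiding permutations\<close>

definition inc_after :: "nat \<Rightarrow> nat set \<Rightarrow> (nat \<Rightarrow> nat) \<Rightarrow> bool" where
  "inc_after t A f \<longleftrightarrow> (\<forall>x\<in>A. \<forall>y\<in>A. t < x \<longrightarrow> x < y \<longrightarrow> f x < f y)"

lemma inc_after_restr [simp]: "inc_after t A (restr f A) = inc_after t A f"
  by (simp add: inc_after_def)

text \<open>The counts of 321-avoiders refined by an increasing suffix obey the recurrence of the ballot numbers,
  since the maximum may be inserted exactly in front of an increasing suffix.\<close>

definition count_321_inc_after :: "nat \<Rightarrow> nat \<Rightarrow> nat" where
  "count_321_inc_after n t = card {f \<in> bijs {1..n} {1..n}. avoids R321 {1..n} f \<and> inc_after t {1..n} f}"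

lemma bijs_image_Diff:
  assumes "f \<in> bijs A B" "a \<in> A"
  shows "f ` (A - {a}) = B - {f a}"
  using inj_on_image_set_diff[OF bijsD(2)[OF assms(1)], of A "{a}"] assms bijsD(3)[OF assms(1)] by simp

text \<open>The maximum can only play the 3 of a 321, so it completes an occurrence exactly when two
  later entries decrease.\<close>

lemma avoids_R321_remove_max:
  assumes f: "f \<in> bijs {1..Suc n} {1..Suc n}" and p: "f p = Suc n" "p \<in> {1..Suc n}"
  shows "avoids R321 {1..Suc n} f \<longleftrightarrow>
           avoids R321 ({1..Suc n} - {p}) f \<and> inc_after p ({1..Suc n} - {p}) f"
proof -
  have lt: "f x < Suc n" if "x \<in> {1..Suc n}" "x \<noteq> p" for x
    using bijsD(4)[OF f that(1)] inj_onD[OF bijsD(2)[OF f], of x p] that p by fastforce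
  show ?thesis
  proof (intro iffI conjI)
    assume av: "avoids R321 {1..Suc n} f"
    then show "avoids R321 ({1..Suc n} - {p}) f" by (rule avoids_subset) auto
    show "inc_after p ({1..Suc n} - {p}) f"
      unfolding inc_after_def
    proof (intro ballI impI)
      fix x y assume *: "x \<in> {1..Suc n} - {p}" "y \<in> {1..Suc n} - {p}" "p < x" "x < y"
      then have "\<not> R321 (f p) (f x) (f y)"
        using av p(2) unfolding avoids_def by (meson DiffD1)
      then have "f x \<le> f y" using lt[of x] * p(1) by (auto simp: R321_def)
      moreover have "f x \<noteq> f y" using inj_onD[OF bijsD(2)[OF f], of x y] * by auto
      ultimately show "f x < f y" by simp
    qed
  next
    assume *: "avoids R321 ({1..Suc n} - {p}) f \<and> inc_after p ({1..Suc n} - {p}) f"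
    show "avoids R321 {1..Suc n} f"
      unfolding avoids_def
    proof (intro ballI impI notI)
      fix x y z assume xyz: "x \<in> {1..Suc n}" "y \<in> {1..Suc n}" "z \<in> {1..Suc n}" "x < y" "y < z" "R321 (f x) (f y) (f z)"
      then have "f y < f x" "f z < f y" by (auto simp: R321_def)
      have y: "y \<noteq> p" using \<open>f y < f x\<close> lt[of x] xyz p by (cases "x = p") auto
      have z: "z \<noteq> p" using \<open>f z < f y\<close> lt[of y] xyz p y by auto
      show False
      proof (cases "x = p")
        case True
        then have "f y < f z" using * y z xyz unfolding inc_after_def by auto
        with \<open>f z < f y\<close> show False by simp
      next
        case False
        then show False using * y z xyz unfolding avoids_def by blast
      qed
    qed
  qed
qed

text \<open>Deleting position \<open>p\<close> moves all later positions down by one. A threshold at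
  or beyond \<open>p\<close> therefore drops by one, and a threshold before \<open>p\<close>
  stays.\<close>

lemma card_remove_max:
  assumes p: "p \<in> {1..Suc n}"
    and P: "\<And>f. f \<in> bijs {1..Suc n} {1..Suc n} \<Longrightarrow> f p = Suc n \<Longrightarrow>
              P f \<longleftrightarrow> avoids R321 ({1..Suc n} - {p}) f \<and> inc_after t ({1..Suc n} - {p}) f"
    and t: "if p \<le> t then t' = t - 1 else t' = t"
  shows "card {f \<in> bijs {1..Suc n} {1..Suc n}. P f \<and> f p = Suc n} = count_321_inc_after n t'"
proof -
  let ?A = "{1..Suc n} - {p}"
  have "card {f \<in> bijs {1..Suc n} {1..Suc n}. P f \<and> f p = Suc n} =
      (\<Sum>f | f \<in> bijs {1..Suc n} {1..Suc n} \<and> f p = Suc n \<and> f ` ?A = {1..n} \<and> P f. 1)"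
    unfolding card_eq_sum
  proof (rule sum.cong)
    have "f ` ?A = {1..n}" if "f \<in> bijs {1..Suc n} {1..Suc n}" "f p = Suc n" for f
      using bijs_image_Diff[OF that(1) p] that(2) by auto
    then show "{f \<in> bijs {1..Suc n} {1..Suc n}. P f \<and> f p = Suc n} =
      {f. f \<in> bijs {1..Suc n} {1..Suc n} \<and> f p = Suc n \<and> f ` ?A = {1..n} \<and> P f}" by blast
  qed simp
  \<comment> \<open>With an empty second block the cut just deletes the pair
    \<open>(p, Suc n)\<close>; the second factor is 1.\<close>
  also have "\<dots> = (\<Sum>f | f \<in> bijs ?A {1..n} \<and> (avoids R321 ?A f \<and> inc_after t ?A f). 1) * card {f \<in> bijs {} {}. True}"
    by (rule sum_bijs_split) (use p P in auto)
  also have "{f \<in> bijs {} {}. True} = {id}" by (auto simp: bijs_def)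
  also have "(\<Sum>f | f \<in> bijs ?A {1..n} \<and> (avoids R321 ?A f \<and> inc_after t ?A f). 1) =
      card {f \<in> bijs ?A {1..n}. avoids R321 ?A f \<and> inc_after t ?A f}" by simp
  also have "\<dots> = count_321_inc_after n t'"
    unfolding count_321_inc_after_def
  proof (rule card_bijs_transfer)
    define \<alpha> where "\<alpha> = (\<lambda>x. if x < p then x else Suc x)"
    have mono: "strict_mono_on {1..n} \<alpha>" by (auto simp: strict_mono_on_def \<alpha>_def)
    have im: "\<alpha> ` {1..n} = ?A"
    proof
      show "?A \<subseteq> \<alpha> ` {1..n}"
      proof
        fix x assume "x \<in> ?A"
        then show "x \<in> \<alpha> ` {1..n}"
          using p by (intro image_eqI[where x = "if x < p then x else x - 1"]) (auto simp: \<alpha>_def)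
      qed
    qed (use p in \<open>auto simp: \<alpha>_def\<close>)
    show \<alpha>: "bij_betw \<alpha> {1..n} ?A"
      using im strict_mono_on_imp_inj_on[OF mono] by (simp add: bij_betw_def)
    show "bij_betw id {1..n} {1..n}" by simp
    fix f g assume fg: "g \<in> bijs {1..n} {1..n}" "\<And>x. x \<in> {1..n} \<Longrightarrow> f (\<alpha> x) = id (g x)"
    have "avoids R321 ?A f = avoids R321 {1..n} g"
      by (rule avoids_transfer[OF order_invariant_R321 \<alpha> mono, where B' = UNIV and \<beta> = id])
         (use fg in \<open>auto simp: strict_mono_on_def\<close>)
    moreover have "inc_after t ?A f = inc_after t' {1..n} g"
    proof -
      have "t < \<alpha> x \<longleftrightarrow> t' < x" for x using t p by (auto simp: \<alpha>_def split: if_splits)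
      then show ?thesis
        unfolding inc_after_def im[symmetric]
        using strict_mono_on_less[OF mono] fg(2) by (simp add: strict_mono_on_def)
    qed
    ultimately show "avoids R321 ?A f \<and> inc_after t ?A f \<longleftrightarrow> avoids R321 {1..n} g \<and> inc_after t' {1..n} g"
      by simp
  qed
  finally show ?thesis by simp
qed

text \<open>Sum over the position \<open>p\<close> of the maximum. If \<open>p <= t\<close>, the
  entries after \<open>p\<close> must increase, which implies the condition after \<open>t\<close>
  and leaves the threshold \<open>p - 1\<close>. In last position the maximum is harmless and the
  threshold stays \<open>t\<close>. Every other position contributes nothing.\<close>

lemma count_321_inc_after_Suc:
  assumes t: "t \<le> n"
  shows "count_321_inc_after (Suc n) t = (\<Sum>p\<le>t. count_321_inc_after n p)"
proof -
  let ?S = "{1..Suc n}"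
  let ?P = "\<lambda>f. avoids R321 ?S f \<and> inc_after t ?S f"
  let ?X = "{f \<in> bijs ?S ?S. ?P f}"
  let ?N = "\<lambda>p. card {f \<in> bijs ?S ?S. ?P f \<and> f p = Suc n}"
  have before: "?N p = count_321_inc_after n (p - 1)" if p: "p \<in> {1..t}" for p
  proof (rule card_remove_max)
    show pS: "p \<in> ?S" using p t by auto
    fix f assume f: "f \<in> bijs ?S ?S" "f p = Suc n"
    have "inc_after t ?S f" if "inc_after p (?S - {p}) f"
      using that p unfolding inc_after_def by auto
    then show "?P f \<longleftrightarrow> avoids R321 (?S - {p}) f \<and> inc_after p (?S - {p}) f"
      using avoids_R321_remove_max[OF f pS] by blast
  qed simp
  have last: "?N (Suc n) = count_321_inc_after n t"
  proof (rule card_remove_max)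
    fix f assume f: "f \<in> bijs ?S ?S" "f (Suc n) = Suc n"
    have "f x < Suc n" if "x \<in> {1..n}" for x
      using bijsD(4)[OF f(1), of x] inj_onD[OF bijsD(2)[OF f(1)], of x "Suc n"] that f(2) by fastforce
    then have "inc_after t ?S f \<longleftrightarrow> inc_after t (?S - {Suc n}) f"
      using f(2) unfolding inc_after_def by (auto simp: le_Suc_eq)
    moreover have "inc_after (Suc n) (?S - {Suc n}) f" by (auto simp: inc_after_def)
    ultimately show "?P f \<longleftrightarrow> avoids R321 (?S - {Suc n}) f \<and> inc_after t (?S - {Suc n}) f"
      using avoids_R321_remove_max[OF f] by simp
  qed (use t in auto)
  \<comment> \<open>Here the maximum lies in the part required to increase, yet is not its last
    entry.\<close>
  have between: "?N p = 0" if p: "p \<in> {t<..n}" for p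
  proof -
    have "False" if "f \<in> bijs ?S ?S" "inc_after t ?S f" "f p = Suc n" for f
    proof -
      have "p \<in> ?S" "Suc n \<in> ?S" "t < p" "p < Suc n" using p by auto
      then have "f p < f (Suc n)" using that(2) unfolding inc_after_def by blast
      then show False using that(3) bijsD(4)[OF that(1), of "Suc n"] by auto
    qed
    then have "{f \<in> bijs ?S ?S. ?P f \<and> f p = Suc n} = {}" by blast
    then show ?thesis by simp
  qed
  have "count_321_inc_after (Suc n) t = (\<Sum>f\<in>?X. 1)" by (simp add: count_321_inc_after_def)
  also have "\<dots> = (\<Sum>p\<in>?S. \<Sum>f\<in>{f \<in> ?X. f p = Suc n}. 1)"
    by (rule sum_bijs_by_preimage[where B = ?S]) auto
  also have "\<dots> = (\<Sum>p\<in>?S. ?N p)" by (simp add: conj_assoc)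
  also have "\<dots> = (\<Sum>p\<in>{1..t} \<union> {t<..n} \<union> {Suc n}. ?N p)"
    by (rule sum.cong) (use t in auto)
  also have "\<dots> = (\<Sum>p\<in>{1..t}. ?N p) + (\<Sum>p\<in>{t<..n}. ?N p) + ?N (Suc n)"
    using t by (subst sum.union_disjoint; (subst sum.union_disjoint)?) auto
  also have "\<dots> = (\<Sum>p\<in>{1..t}. count_321_inc_after n (p - 1)) + count_321_inc_after n t"
    using before between last by simp
  also have "(\<Sum>p\<in>{1..t}. count_321_inc_after n (p - 1)) = (\<Sum>p<t. count_321_inc_after n p)"
    by (rule sum.reindex_bij_witness[of _ Suc "\<lambda>p. p - 1"]) auto
  finally show ?thesis by (simp add: lessThan_Suc_atMost[symmetric])
qed

text \<open>Beyond either threshold there is at most one position, so both conditions are vacuous.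
  This gives the boundary equation of the ballot recurrence.\<close>

lemma count_321_inc_after_Suc_Suc: "count_321_inc_after (Suc n) (Suc n) = count_321_inc_after (Suc n) n"
  unfolding count_321_inc_after_def inc_after_def by (rule arg_cong[where f = card]) auto

lemma count_321_inc_after_0: "count_321_inc_after 0 t = 1"
proof -
  have "{f \<in> bijs {1..0} {1..0}. avoids R321 {1..0} f \<and> inc_after t {1..0} f} = {id}"
    by (auto simp: bijs_def avoids_def inc_after_def)
  then show ?thesis by (simp add: count_321_inc_after_def)
qed

lemma card_perms_avoiding_R321: "card (perms_avoiding R321 n) = count_321_inc_after n n"
  unfolding perms_avoiding_def count_321_inc_after_def inc_after_def by (rule arg_cong[where f = card]) auto

subsection \<open>Fixed points of 132-avoiding permutations\<close>

text \<open>The last entry \<open>v\<close> can play the 2 of a 132, so all larger entries must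
  precede all smaller ones. The two groups are then independent avoiders, which gives the Catalan
  recurrence.\<close>

lemma card_perms_avoiding_R132_Suc:
  "card (perms_avoiding R132 (Suc n)) = (\<Sum>i\<le>n. card (perms_avoiding R132 i) * card (perms_avoiding R132 (n - i)))"
proof -
  let ?S = "{1..Suc n}"
  let ?X = "perms_avoiding R132 (Suc n)"
  let ?c = "\<lambda>m. card (perms_avoiding R132 m)"
  have *: "card {f \<in> ?X. f (Suc n) = v} = ?c (Suc n - v) * ?c (v - 1)" if v: "v \<in> ?S" for v
  proof -
    let ?A1 = "{1..Suc n - v}" and ?B1 = "{Suc v..Suc n}"
    let ?A2 = "{Suc (Suc n - v)..n}" and ?B2 = "{1..<v}"
    have im: "f ` ?A1 = ?B1" if f: "f \<in> ?X" "f (Suc n) = v" for f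
    proof -
      have f': "f \<in> bijs ?S ?S" and av: "avoids R132 ?S f" using f(1) by (auto simp: perms_avoiding_def)
      \<comment> \<open>\<open>D\<close> holds the positions of the larger entries. It is an initial
        segment, because a smaller entry before a larger one would form a 132 with the last
        entry.\<close>
      define D where "D = {x \<in> {1..n}. v < f x}"
      have "f ` D = ?B1"
      proof
        show "?B1 \<subseteq> f ` D"
        proof
          fix w assume w: "w \<in> ?B1"
          then have "w \<in> f ` ?S" using bijsD(3)[OF f'] v by auto
          then obtain x where "x \<in> ?S" "w = f x" by blast
          with w f(2) show "w \<in> f ` D" by (cases "x = Suc n") (auto simp: D_def)
        qed
        show "f ` D \<subseteq> ?B1"
        proof (rule image_subsetI)
          fix x assume "x \<in> D"
          then show "f x \<in> ?B1" using bijsD(4)[OF f', of x] by (auto simp: D_def)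
        qed
      qed
      moreover have "card (f ` D) = card D"
        by (rule card_image, rule inj_on_subset[OF bijsD(2)[OF f']]) (auto simp: D_def)
      ultimately have "card D = Suc n - v" using v by simp
      moreover have "D = {1..card D}"
      proof (rule down_closed_eq_atLeastAtMost)
        show "D \<subseteq> {1..n}" by (auto simp: D_def)
        fix x y assume xy: "y \<in> D" "1 \<le> x" "x < y"
        then have "\<not> R132 (f x) (f y) (f (Suc n))"
          using av unfolding avoids_def D_def by auto
        then have "\<not> f x < v" using xy f(2) by (auto simp: R132_def D_def)
        moreover have "f x \<noteq> v"
          using inj_onD[OF bijsD(2)[OF f'], of x "Suc n"] xy f(2) by (auto simp: D_def)
        ultimately show "x \<in> D" using xy by (auto simp: D_def)
      qed
      ultimately show ?thesis using \<open>f ` D = ?B1\<close> by metis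
    qed
    have "card {f \<in> ?X. f (Suc n) = v} =
        (\<Sum>f | f \<in> bijs ?S ?S \<and> f (Suc n) = v \<and> f ` ?A1 = ?B1 \<and> avoids R132 ?S f. 1)"
      unfolding card_eq_sum using im by (intro sum.cong) (auto simp: perms_avoiding_def)
    also have "\<dots> = (\<Sum>f | f \<in> bijs ?A1 ?B1 \<and> avoids R132 ?A1 f. 1) * card {f \<in> bijs ?A2 ?B2. avoids R132 ?A2 f}"
    proof (rule sum_bijs_split)
      fix f assume f: "f \<in> bijs ?S ?S" "f (Suc n) = v" "f ` ?A1 = ?B1"
      have gt: "v < f x" if "x \<in> ?A1" for x
        using imageI[OF that, of f] unfolding f(3) by simp
      have le: "f x < v" if "x \<in> ?A2" for x
      proof (rule ccontr)
        assume "\<not> f x < v"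
        moreover have "f x \<noteq> v" using inj_onD[OF bijsD(2)[OF f(1)], of x "Suc n"] that f(2) by auto
        ultimately have "f x \<in> f ` ?A1" using bijsD(4)[OF f(1), of x] that unfolding f(3) by auto
        then obtain y where "y \<in> ?A1" "f y = f x" by (metis imageE)
        then show False using inj_onD[OF bijsD(2)[OF f(1)], of y x] that v by auto
      qed
      show "avoids R132 ?S f \<longleftrightarrow> avoids R132 ?A1 f \<and> avoids R132 ?A2 f"
      proof safe
        assume 1: "avoids R132 ?A1 f" and 2: "avoids R132 ?A2 f"
        show "avoids R132 ?S f"
          unfolding avoids_def
        proof (intro ballI impI notI)
          fix x y z assume xyz: "x \<in> ?S" "y \<in> ?S" "z \<in> ?S" "x < y" "y < z" "R132 (f x) (f y) (f z)"
          then have lt: "f x < f z" "f z < f y" by (auto simp: R132_def)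
          have "x \<in> ?A1 \<or> x \<in> ?A2" "y \<in> ?A1 \<or> y \<in> ?A2" "z \<in> ?A1 \<or> z \<in> ?A2 \<or> z = Suc n" using xyz by auto
          \<comment> \<open>The only triples across the blocks start in the high block and end
            lower, or end at \<open>v\<close> after an entry below \<open>v\<close>; neither has the
            order type 132.\<close>
          then consider "x \<in> ?A1" "y \<in> ?A1" "z \<in> ?A1" | "x \<in> ?A2" "y \<in> ?A2" "z \<in> ?A2"
            | "x \<in> ?A1" "z \<in> ?A2 \<or> z = Suc n" | "x \<in> ?A2" "y \<in> ?A2" "z = Suc n"
            using xyz(4,5) by fastforce
          then show False
          proof cases
            case 1
            then show False using \<open>avoids R132 ?A1 f\<close> xyz unfolding avoids_def by blast
          next
            case 2
            then show False using \<open>avoids R132 ?A2 f\<close> xyz unfolding avoids_def by blast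
          next
            case 3
            then show False using gt[of x] le[of z] lt f(2) by auto
          next
            case 4
            then show False using le[of y] lt f(2) by auto
          qed
        qed
      qed (erule avoids_subset, use v in auto)+
    qed (use v in \<open>auto cong: conj_cong\<close>)
    also have "(\<Sum>f | f \<in> bijs ?A1 ?B1 \<and> avoids R132 ?A1 f. 1) = ?c (Suc n - v)"
      using card_avoids_shift[OF order_invariant_R132, of 0 "Suc n - v" v] v by simp
    also have "card {f \<in> bijs ?A2 ?B2. avoids R132 ?A2 f} = ?c (v - 1)"
    proof -
      have "{1..<v} = {1..v - 1}" using v by auto
      then show ?thesis
        using card_avoids_shift[OF order_invariant_R132, of "Suc n - v" "v - 1" 0] v by simp
    qed
    finally show ?thesis .
  qed
  have "card ?X = (\<Sum>f\<in>?X. 1)" by simp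
  also have "\<dots> = (\<Sum>v\<in>?S. \<Sum>f\<in>{f \<in> ?X. f (Suc n) = v}. 1)"
    by (rule sum_bijs_by_value[OF _ _ perms_avoiding_subset]) auto
  also have "\<dots> = (\<Sum>v\<in>?S. ?c (Suc n - v) * ?c (v - 1))" using * by simp
  also have "\<dots> = (\<Sum>i\<le>n. ?c i * ?c (n - i))"
    by (rule sum.reindex_bij_witness[of _ "\<lambda>i. Suc n - i" "\<lambda>v. Suc n - v"]) auto
  finally show ?thesis .
qed

lemma card_perms_avoiding_0: "card (perms_avoiding R 0) = 1"
proof -
  have "perms_avoiding R 0 = {id}" by (auto simp: perms_avoiding_def bijs_def avoids_def)
  then show ?thesis by simp
qed

section \<open>Corners of 132-avoiding permutations\<close>

definition corner :: "nat \<Rightarrow> nat set \<Rightarrow> (nat \<Rightarrow> nat) \<Rightarrow> bool" where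
  "corner k A f \<longleftrightarrow> (\<forall>x\<in>A. x \<le> k \<longrightarrow> k < f x) \<and>
     (\<forall>x\<in>A. \<forall>y\<in>A. k < x \<longrightarrow> x < y \<longrightarrow> k < f x \<longrightarrow> k < f y \<longrightarrow> f x < f y)"

lemma corner_restr [simp]: "corner k A (restr f A) = corner k A f"
  by (simp add: corner_def)

text \<open>The corner of \<open>f\<close> is the unique diagonal position at which a block with a final fixed point
  can be inserted without creating the pattern 132.\<close>

lemma ex1_corner:
  assumes f: "f \<in> perms_avoiding R132 m"
  shows "\<exists>!k. k \<le> m \<and> corner k {1..m} f"
proof -
  have f': "f \<in> bijs {1..m} {1..m}" and av: "avoids R132 {1..m} f" using f by (auto simp: perms_avoiding_def)
  \<comment> \<open>The corner is the largest \<open>k\<close> such that the first \<open>k\<close>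
    entries all exceed \<open>k\<close>; 0 always qualifies.\<close>
  define K where "K = {k. k \<le> m \<and> (\<forall>x\<in>{1..k}. k < f x)}"
  have fin: "finite K" "K \<noteq> {}" by (auto simp: K_def)
  define k where "k = Max K"
  have k: "k \<le> m" "\<And>x. x \<in> {1..k} \<Longrightarrow> k < f x"
    using Max_in[OF fin] by (auto simp: k_def K_def)
  have max: "k' \<le> k" if "k' \<in> K" for k' using fin that by (simp add: k_def)
  have "corner k {1..m} f"
    unfolding corner_def
  proof (intro conjI ballI impI)
    fix x y assume xy: "x \<in> {1..m}" "y \<in> {1..m}" "k < x" "x < y" "k < f x" "k < f y"
    show "f x < f y"
    proof (rule ccontr)
      assume "\<not> f x < f y"
      moreover have "f x \<noteq> f y" using inj_onD[OF bijsD(2)[OF f'], of x y] xy by auto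
      ultimately have less: "f y < f x" by simp
      \<comment> \<open>Maximality supplies an entry \<open>f z\<close> of at most
        \<open>Suc k\<close> among the first \<open>Suc k\<close> positions. It precedes the descent
        at \<open>x\<close>, \<open>y\<close> and lies below it, so the three form a 132.\<close>
      have "Suc k \<notin> K" using max by fastforce
      moreover have "Suc k \<le> m" using xy by auto
      ultimately obtain z where z: "z \<in> {1..Suc k}" "f z \<le> Suc k" by (auto simp: K_def not_less)
      have "z \<noteq> x"
        using less xy z by auto
      then have "z < x" using z xy by auto
      moreover have "f z < f y"
      proof -
        have "f z \<noteq> f y" using inj_onD[OF bijsD(2)[OF f'], of z y] xy \<open>z < x\<close> z(1) by auto
        then show ?thesis using z(2) xy by simp
      qed
      ultimately have "R132 (f z) (f x) (f y)" "z < x" using less by (auto simp: R132_def)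
      moreover have "z \<in> {1..m}" using z(1) xy by auto
      ultimately show False using av xy unfolding avoids_def by blast
    qed
  qed (use k in auto)
  moreover have "k' = k" if k': "k' \<le> m" "corner k' {1..m} f" for k'
  proof (rule ccontr)
    assume "k' \<noteq> k"
    moreover have "k' \<in> K" using k' unfolding corner_def K_def by auto
    ultimately have "k' < k" using max[of k'] by simp
    \<comment> \<open>With a smaller corner \<open>k'\<close>, position \<open>Suc k'\<close> has a
      value above \<open>k\<close>, whereas the value \<open>Suc k'\<close> occurs only beyond
      position \<open>k\<close>. Both entries lie beyond \<open>k'\<close> in position and value but
      decrease.\<close>
    have "Suc k' \<in> f ` {1..m}" using \<open>k' < k\<close> k(1) bijsD(3)[OF f'] by auto
    then obtain y where y: "y \<in> {1..m}" "f y = Suc k'" by (metis imageE)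
    have "k < y" using k(2)[of y] y \<open>k' < k\<close> by (cases "y \<le> k") auto
    moreover have "k' < f (Suc k')" using k(2)[of "Suc k'"] \<open>k' < k\<close> by auto
    moreover have "Suc k' \<in> {1..m}" using \<open>k' < k\<close> k(1) by auto
    moreover have "k' < Suc k'" "Suc k' < y" "k' < f y" using \<open>k' < k\<close> \<open>k < y\<close> y by auto
    ultimately have "f (Suc k') < f y"
      using k'(2) y(1) unfolding corner_def by blast
    then show False using y k(2)[of "Suc k'"] \<open>k' < k\<close> by auto
  qed
  ultimately show ?thesis using k(1) by blast
qed

text \<open>By existence and uniqueness of the corner, the classes partition the avoiders. This
  later removes the corner condition from the moment recurrence.\<close>

lemma sum_card_corner:
  "(\<Sum>k\<le>m. card {f \<in> perms_avoiding R132 m. corner k {1..m} f}) = card (perms_avoiding R132 m)"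
proof -
  have "perms_avoiding R132 m = (\<Union>k\<le>m. {f \<in> perms_avoiding R132 m. corner k {1..m} f})"
    using ex1_corner by blast
  then have "card (perms_avoiding R132 m) = card (\<Union>k\<le>m. {f \<in> perms_avoiding R132 m. corner k {1..m} f})"
    by simp
  also have "\<dots> = (\<Sum>k\<le>m. card {f \<in> perms_avoiding R132 m. corner k {1..m} f})"
  proof (rule card_UN_disjoint)
    show "\<forall>i\<in>{..m}. \<forall>j\<in>{..m}. i \<noteq> j \<longrightarrow>
        {f \<in> perms_avoiding R132 m. corner i {1..m} f} \<inter> {f \<in> perms_avoiding R132 m. corner j {1..m} f} = {}"
      using ex1_corner by blast
  qed auto
  finally show ?thesis by simp
qed

section \<open>Blocks ending at a fixed point of a 132-avoider\<close>

text \<open>Among the entries before \<open>i\<close>, those above \<open>i\<close> come first, as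
  otherwise \<open>i\<close> would be the 2 of a 132. The remaining values below \<open>i\<close>
  must be the topmost ones: a missing larger value would stand to the right of \<open>i\<close>,
  with \<open>i\<close> as the 3.\<close>

lemma R132_fixed_point_block:
  assumes f: "f \<in> perms_avoiding R132 n" and i: "f i = i" "i \<in> {1..n}"
  obtains k where "k < i" "f ` {k+1..<i} = {k+1..<i}" "\<And>x. x \<in> {1..k} \<Longrightarrow> i < f x"
proof -
  have f': "f \<in> bijs {1..n} {1..n}" and av: "avoids R132 {1..n} f" using f by (auto simp: perms_avoiding_def)
  have neq: "f x \<noteq> i" if "x \<in> {1..n}" "x \<noteq> i" for x
    using inj_onD[OF bijsD(2)[OF f'], of x i] that i by auto
  have no132: "\<not> R132 (f x) (f y) (f z)" if "x \<in> {1..n}" "y \<in> {1..n}" "z \<in> {1..n}" "x < y" "y < z" for x y z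
    using av that unfolding avoids_def by blast
  define D where "D = {x \<in> {1..<i}. i < f x}"
  define k where "k = card D"
  have "D = {1..card D}"
  proof (rule down_closed_eq_atLeastAtMost)
    show "D \<subseteq> {1..i - 1}" by (auto simp: D_def)
    fix x y assume xy: "y \<in> D" "1 \<le> x" "x < y"
    then have "\<not> f x < i"
      using no132[of x y i] i by (auto simp: D_def R132_def)
    then show "x \<in> D" using xy neq[of x] i by (auto simp: D_def)
  qed
  then have D: "D = {1..k}" by (simp only: k_def)
  have "k < i"
  proof -
    have "k \<le> card {1..<i}" unfolding k_def by (rule card_mono) (auto simp: D_def)
    then show ?thesis using i by auto
  qed
  have big: "i < f x" if "x \<in> {1..k}" for x using that unfolding D[symmetric] by (simp add: D_def)
  have small: "f x < i" if "x \<in> {k+1..<i}" for x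
  proof -
    have "x \<notin> D" using that unfolding D by simp
    then show ?thesis using neq[of x] that i(2) by (auto simp: D_def)
  qed
  \<comment> \<open>\<open>?V\<close> is closed upwards below \<open>i\<close>, so its size alone
    shows that it is \<open>{k+1..<i}\<close>.\<close>
  let ?V = "f ` {k+1..<i}"
  have "?V = {Suc (i - 1 - card ?V)..i - 1}"
  proof (rule up_closed_eq_atLeastAtMost)
    show "?V \<subseteq> {1..i - 1}"
    proof (rule image_subsetI)
      fix x assume x: "x \<in> {k+1..<i}"
      then have "x \<in> {1..n}" using i(2) by auto
      then show "f x \<in> {1..i - 1}" using small[OF x] bijsD(4)[OF f', of x] by auto
    qed
    fix v w assume vw: "v \<in> ?V" "v < w" "w \<le> i - 1"
    then obtain x where x: "x \<in> {k+1..<i}" "v = f x" by blast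
    have "w \<in> f ` {1..n}" using vw i(2) bijsD(3)[OF f'] by auto
    then obtain z where z: "z \<in> {1..n}" "w = f z" by blast
    have "\<not> z \<le> k" using big[of z] z vw(3) by auto
    moreover have "\<not> i \<le> z"
    proof
      assume "i \<le> z"
      then have "i < z" using z i vw(2,3) by (cases "z = i") auto
      then have "\<not> R132 (f x) (f i) (f z)" using no132[of x i z] x z i by auto
      then show False using x z vw i by (auto simp: R132_def)
    qed
    ultimately show "w \<in> ?V" using z by auto
  qed
  moreover have "card ?V = i - (k + 1)"
    by (subst card_image, rule inj_on_subset[OF bijsD(2)[OF f']]) (use i in auto)
  ultimately have "?V = {Suc (i - 1 - (i - (k + 1)))..i - 1}" by metis
  also have "\<dots> = {k+1..<i}" using \<open>k < i\<close> by auto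
  finally show ?thesis using that[of k] \<open>k < i\<close> big by simp
qed

text \<open>Entries off the block have values at most \<open>k\<close> or above \<open>i\<close>.
  Hence \<open>corner k A f\<close> says two things: the first \<open>k\<close> entries exceed
  \<open>i\<close>, and later entries above \<open>i\<close> increase, so that neither
  \<open>i\<close> nor a block entry is the 1 of a 132 with them.\<close>

lemma R132_avoids_block_iff:
  assumes f: "f \<in> bijs {1..n} {1..n}" and i: "f i = i" "i \<in> {1..n}" and k: "k < i"
    and block: "f ` {k+1..<i} = {k+1..<i}"
  defines "A \<equiv> {1..k} \<union> {i+1..n}"
  shows "avoids R132 {1..n} f \<and> (\<forall>x\<in>{1..k}. i < f x) \<longleftrightarrow>
           avoids R132 {k+1..<i} f \<and> (avoids R132 A f \<and> corner k A f)"
proof -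
  let ?B = "{k+1..<i}"
  have in_block: "f x \<in> ?B" if "x \<in> ?B" for x using block that by blast
  have off_block: "f x \<le> k \<or> i < f x" if "x \<in> A" for x
  proof -
    have x: "x \<in> {1..n}" "x \<notin> insert i ?B" using that i k by (auto simp: A_def)
    have "insert i ?B \<subseteq> {1..n}" using i(2) by auto
    then have "f x \<notin> f ` insert i ?B"
      using inj_on_image_mem_iff[OF bijsD(2)[OF f] x(1)] x(2) by blast
    then have "f x \<notin> insert i ?B" using block i(1) by simp
    then show ?thesis using k by auto
  qed
  have cases: "x \<in> A \<or> x \<in> ?B \<or> x = i" if "x \<in> {1..n}" for x
    using that by (auto simp: A_def)
  show ?thesis
  proof (intro iffI conjI)
    assume *: "avoids R132 {1..n} f \<and> (\<forall>x\<in>{1..k}. i < f x)"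
    have "?B \<subseteq> {1..n}" "A \<subseteq> {1..n}" using i k by (auto simp: A_def)
    then show "avoids R132 ?B f" "avoids R132 A f"
      using * avoids_subset by blast+
    show "corner k A f"
      unfolding corner_def
    proof (intro conjI ballI impI)
      fix x assume "x \<in> A" "x \<le> k"
      then have "i < f x" using * by (auto simp: A_def)
      then show "k < f x" using k by simp
    next
      fix x y assume xy: "x \<in> A" "y \<in> A" "k < x" "x < y" "k < f x" "k < f y"
      then have "i < x" "i < f x" "i < f y" "x \<in> {1..n}" "y \<in> {1..n}"
        using off_block[of x] off_block[of y] by (auto simp: A_def)
      moreover from this have "\<not> R132 (f i) (f x) (f y)"
        using * i xy(4) unfolding avoids_def by blast
      moreover have "f x \<noteq> f y"
        using inj_onD[OF bijsD(2)[OF f], of x y] xy(4) calculation by auto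
      ultimately show "f x < f y" using i(1) by (auto simp: R132_def)
    qed
  next
    assume *: "avoids R132 ?B f \<and> (avoids R132 A f \<and> corner k A f)"
    show big: "\<forall>x\<in>{1..k}. i < f x"
    proof
      fix x assume "x \<in> {1..k}"
      then have "x \<in> A" "k < f x" using * by (auto simp: A_def corner_def)
      then show "i < f x" using off_block[of x] by simp
    qed
    show "avoids R132 {1..n} f"
      unfolding avoids_def
    proof (intro ballI impI notI)
      fix x y z assume xyz: "x \<in> {1..n}" "y \<in> {1..n}" "z \<in> {1..n}" "x < y" "y < z" "R132 (f x) (f y) (f z)"
      then have lt: "f x < f z" "f z < f y" by (auto simp: R132_def)
      have A: "\<not> (x \<in> A \<and> y \<in> A \<and> z \<in> A)" and B: "\<not> (x \<in> ?B \<and> y \<in> ?B \<and> z \<in> ?B)"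
        using * xyz unfolding avoids_def by blast+
      show False
      \<comment> \<open>Split by the 1 of the pattern. If it lies in \<open>A\<close>, the whole
        triple is forced into \<open>A\<close>. Otherwise any entries from \<open>A\<close> lie
        beyond \<open>i\<close> with values above \<open>i\<close>, where the corner condition
        applies; the remaining triples lie inside the block.\<close>
      proof (cases "x \<in> A")
        case True
        show False
        proof (cases "x \<le> k")
          case True
          then have "i < f x" using big xyz(1) by auto
          then have "y \<notin> insert i ?B" "z \<notin> insert i ?B"
            using lt in_block[of y] in_block[of z] i(1) by auto
          then show False using A \<open>x \<in> A\<close> cases xyz by blast
        next
          case False
          then have "i < x" using \<open>x \<in> A\<close> by (auto simp: A_def)
          then show False using A \<open>x \<in> A\<close> xyz by (auto simp: A_def)
        qed
      next
        case False
        then have x: "k < x" "x \<le> i" "k < f x"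
          using cases[OF xyz(1)] in_block[of x] i(1) k by auto
        have "y \<in> A \<Longrightarrow> i < f y" "z \<in> A \<Longrightarrow> i < f z"
          using off_block lt x(3) by fastforce+
        then consider "y \<in> A" "i < f y" "z \<in> A" "i < f z" | "y \<notin> A" "z \<in> A" "i < f z" | "y \<in> A" "z \<notin> A" | "y \<notin> A" "z \<notin> A"
          by blast
        then show False
        proof cases
          case 1
          then have "f y < f z" using * x xyz unfolding corner_def by auto
          then show False using lt by simp
        next
          case 2
          then show False using lt cases[OF xyz(2)] in_block[of y] i(1) by auto
        next
          case 3
          then have "i < y" using x xyz by (auto simp: A_def)
          then show False using 3 xyz by (auto simp: A_def)
        next
          case 4
          then have "y \<le> i" "z \<le> i" using cases[OF xyz(2)] cases[OF xyz(3)] by auto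
          moreover have "z \<noteq> i"
            using lt 4 cases[OF xyz(2)] in_block[of y] i(1) by auto
          ultimately show False using B x xyz by auto
        qed
      qed
    qed
  qed
qed

lemma sum_fp_shift:
  assumes R: "order_invariant R"
  shows "(\<Sum>f | f \<in> bijs {k+1..k+l} {k+1..k+l} \<and> avoids R {k+1..k+l} f.
            card {x \<in> {k+1..k+l}. f x = x} choose j) = fp_moment R l j"
  unfolding fp_moment_def perms_avoiding_def
  unfolding mem_Collect_eq
proof (rule sum_bijs_transfer[where \<alpha> = "\<lambda>x. x + k" and \<beta> = "\<lambda>x. x + k"])
  show \<alpha>: "bij_betw (\<lambda>x. x + k) {1..l} {k+1..k+l}" "bij_betw (\<lambda>x. x + k) {1..l} {k+1..k+l}"
    by (simp_all add: bij_betw_def add.commute)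
  fix f g assume fg: "g \<in> bijs {1..l} {1..l}" "\<And>x. x \<in> {1..l} \<Longrightarrow> f (x + k) = g x + k"
  then show "avoids R {k+1..k+l} f \<longleftrightarrow> avoids R {1..l} g"
    by (intro avoids_transfer[OF R \<alpha>(1), where \<beta> = "\<lambda>x. x + k" and B' = "{1..l}"])
       (auto simp: strict_mono_on_def dest: bijsD)
  have "{x \<in> {k+1..k+l}. f x = x} = (\<lambda>x. x + k) ` {x \<in> {1..l}. g x = x}"
  proof (intro equalityI subsetI)
    fix x assume "x \<in> {x \<in> {k+1..k+l}. f x = x}"
    then have "x - k \<in> {1..l}" "x - k + k = x" "f x = x" by auto
    then show "x \<in> (\<lambda>x. x + k) ` {x \<in> {1..l}. g x = x}"
      using fg(2)[of "x - k"] by (intro image_eqI[where x = "x - k"]) simp_all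
  qed (use fg(2) in auto)
  then have "card {x \<in> {k+1..k+l}. f x = x} = fp l g"
    unfolding fp_def by (simp add: card_image)
  then show "card {x \<in> {k+1..k+l}. f x = x} choose j = fp l g choose j" by simp
qed

text \<open>Closing the gap \<open>k+1..i\<close> leaves \<open>k + (n - i)\<close> points. The
  shift by \<open>i - k\<close> beyond \<open>k\<close> preserves all comparisons with
  \<open>k\<close>, so the corner stays at \<open>k\<close>.\<close>

lemma card_bijs_corner:
  assumes i: "i \<in> {1..n}" and k: "k < i"
  defines "A \<equiv> {1..k} \<union> {i+1..n}"
  shows "card {f \<in> bijs A A. avoids R132 A f \<and> corner k A f} =
           card {f \<in> perms_avoiding R132 (n - i + k). corner k {1..n - i + k} f}"
proof -
  define m where "m = n - i + k"
  define \<alpha> where "\<alpha> x = (if x \<le> k then x else x + (i - k))" for x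
  have mono: "strict_mono \<alpha>" by (auto simp: strict_mono_def \<alpha>_def)
  have im: "\<alpha> ` {1..m} = A"
  proof (intro equalityI subsetI)
    fix x assume "x \<in> A"
    then show "x \<in> \<alpha> ` {1..m}"
      using i k by (intro image_eqI[where x = "if x \<le> k then x else x - (i - k)"]) (auto simp: A_def m_def \<alpha>_def)
  qed (use i k in \<open>auto simp: A_def m_def \<alpha>_def\<close>)
  have \<alpha>: "bij_betw \<alpha> {1..m} A"
    using im strict_mono_imp_inj_on[OF mono] by (simp add: bij_betw_def inj_on_def)
  have "card {f \<in> bijs A A. avoids R132 A f \<and> corner k A f} =
      card {f \<in> bijs {1..m} {1..m}. avoids R132 {1..m} f \<and> corner k {1..m} f}"
  proof (rule card_bijs_transfer[OF \<alpha> \<alpha>])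
    fix f g assume fg: "g \<in> bijs {1..m} {1..m}" "\<And>x. x \<in> {1..m} \<Longrightarrow> f (\<alpha> x) = \<alpha> (g x)"
    have mono_on: "strict_mono_on UNIV \<alpha>" "strict_mono_on {1..m} \<alpha>"
      using mono by (auto simp: strict_mono_def strict_mono_on_def)
    have "avoids R132 A f = avoids R132 {1..m} g"
      by (rule avoids_transfer[OF order_invariant_R132 \<alpha> mono_on(2,1)]) (use fg(2) in auto)
    moreover have "corner k A f = corner k {1..m} g"
    proof -
      have *: "\<alpha> x \<le> k \<longleftrightarrow> x \<le> k" "k < \<alpha> x \<longleftrightarrow> k < x" for x using k by (auto simp: \<alpha>_def)
      show ?thesis
        unfolding corner_def im[symmetric]
        using strict_mono_less[OF mono] fg(2) * by simp
    qed
    ultimately show "avoids R132 A f \<and> corner k A f \<longleftrightarrow> avoids R132 {1..m} g \<and> corner k {1..m} g"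
      by simp
  qed
  then show ?thesis by (simp add: perms_avoiding_def m_def conj_assoc)
qed

text \<open>The last marked fixed point \<open>i\<close> closes a block of size
  \<open>l = i - 1 - k\<close> that contains all other marks. For fixed \<open>l\<close> the offset
  \<open>k\<close> runs over all corners of the outer avoider of size \<open>n - 1 - l\<close>, so
  the corner classes sum to all avoiders.\<close>

lemma fp_moment_R132_Suc:
  "fp_moment R132 n (Suc j) = (\<Sum>l<n. fp_moment R132 l j * card (perms_avoiding R132 (n - 1 - l)))"
proof -
  define Q where "Q m k = card {f \<in> perms_avoiding R132 m. corner k {1..m} f}" for m k
  have *: "(\<Sum>f | f \<in> perms_avoiding R132 n \<and> f i = i. card {x \<in> {1..<i}. f x = x} choose j) =
      (\<Sum>k<i. fp_moment R132 (i - 1 - k) j * Q (n - i + k) k)" if i: "i \<in> {1..n}" for i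
  proof -
    let ?X = "{f. f \<in> perms_avoiding R132 n \<and> f i = i}"
    let ?P = "\<lambda>k f. f ` {k+1..<i} = {k+1..<i} \<and> (\<forall>x\<in>{1..k}. i < f x)"
    let ?D = "\<lambda>k. {f \<in> ?X. ?P k f}"
    have "(\<Sum>f\<in>?X. card {x \<in> {1..<i}. f x = x} choose j) =
        (\<Sum>f\<in>(\<Union>k<i. ?D k). card {x \<in> {1..<i}. f x = x} choose j)"
    proof (rule sum.cong)
      show "?X = (\<Union>k<i. ?D k)"
      proof (intro equalityI subsetI)
        fix f assume f: "f \<in> ?X"
        then obtain k where "k < i" "f ` {k+1..<i} = {k+1..<i}" "\<And>x. x \<in> {1..k} \<Longrightarrow> i < f x"
          using R132_fixed_point_block[OF _ _ i] by blast
        then show "f \<in> (\<Union>k<i. ?D k)" using f by blast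
      qed auto
    qed simp
    also have "\<dots> = (\<Sum>k<i. \<Sum>f\<in>?D k. card {x \<in> {1..<i}. f x = x} choose j)"
    proof (rule sum.UNION_disjoint)
      \<comment> \<open>With two different offsets, position \<open>Suc k\<close> would have a value
        inside the block and also one above \<open>i\<close>.\<close>
      have disj: "?D k \<inter> ?D k' = {}" if "k < k'" "k' < i" for k k'
      proof (rule equals0I)
        fix f assume f: "f \<in> ?D k \<inter> ?D k'"
        have "Suc k \<in> {k+1..<i}" "Suc k \<in> {1..k'}" using that by auto
        then have "f (Suc k) \<in> {k+1..<i}" "i < f (Suc k)" using f by blast+
        then show False by simp
      qed
      show "\<forall>k\<in>{..<i}. \<forall>k'\<in>{..<i}. k \<noteq> k' \<longrightarrow> ?D k \<inter> ?D k' = {}"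
      proof (intro ballI impI)
        fix k k' assume "k \<in> {..<i}" "k' \<in> {..<i}" "k \<noteq> k'"
        then consider "k < k'" "k' < i" | "k' < k" "k < i" by fastforce
        then show "?D k \<inter> ?D k' = {}"
        proof cases
          case 1
          then show ?thesis by (rule disj)
        next
          case 2
          then show ?thesis using disj[of k' k] by (simp only: Int_commute)
        qed
      qed
    qed auto
    also have "\<dots> = (\<Sum>k<i. fp_moment R132 (i - 1 - k) j * Q (n - i + k) k)"
    proof (rule sum.cong)
      fix k assume "k \<in> {..<i}"
      then have k: "k < i" by simp
      let ?S = "{1..n}" and ?A = "{1..k} \<union> {i+1..n}" and ?B = "{k+1..<i}"
      have "(\<Sum>f\<in>?D k. card {x \<in> {1..<i}. f x = x} choose j) =
          (\<Sum>f | f \<in> bijs ?S ?S \<and> f i = i \<and> f ` ?B = ?B \<and> (avoids R132 ?S f \<and> (\<forall>x\<in>{1..k}. i < f x)).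
             card {x \<in> ?B. f x = x} choose j)"
      proof (rule sum.cong)
        fix f assume "f \<in> {f. f \<in> bijs ?S ?S \<and> f i = i \<and> f ` ?B = ?B \<and> (avoids R132 ?S f \<and> (\<forall>x\<in>{1..k}. i < f x))}"
        \<comment> \<open>The first \<open>k\<close> entries exceed \<open>i\<close>, so all fixed
          points before \<open>i\<close> lie in the block.\<close>
        then have "f x \<noteq> x" if "x \<in> {1..k}" for x using that k by fastforce
        then have "{x \<in> {1..<i}. f x = x} = {x \<in> ?B. f x = x}" by force
        then show "card {x \<in> {1..<i}. f x = x} choose j = card {x \<in> ?B. f x = x} choose j" by simp
      qed (auto simp: perms_avoiding_def)
      also have "\<dots> = (\<Sum>f | f \<in> bijs ?B ?B \<and> avoids R132 ?B f. card {x \<in> ?B. f x = x} choose j) *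
          card {f \<in> bijs ?A ?A. avoids R132 ?A f \<and> corner k ?A f}"
      proof (rule sum_bijs_split)
        fix f assume "f \<in> bijs ?S ?S" "f i = i" "f ` ?B = ?B"
        then show "avoids R132 ?S f \<and> (\<forall>x\<in>{1..k}. i < f x) \<longleftrightarrow>
            avoids R132 ?B f \<and> (avoids R132 ?A f \<and> corner k ?A f)"
          using i k by (intro R132_avoids_block_iff)
      qed (use i k in \<open>auto cong: conj_cong\<close>)
      also have "card {f \<in> bijs ?A ?A. avoids R132 ?A f \<and> corner k ?A f} = Q (n - i + k) k"
        unfolding Q_def by (rule card_bijs_corner[OF i k])
      also have "(\<Sum>f | f \<in> bijs ?B ?B \<and> avoids R132 ?B f. card {x \<in> ?B. f x = x} choose j) =
          fp_moment R132 (i - 1 - k) j"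
      proof -
        have "?B = {k+1..k + (i - 1 - k)}" using k by auto
        then show ?thesis using sum_fp_shift[OF order_invariant_R132, of k "i - 1 - k" j] by simp
      qed
      finally show "(\<Sum>f\<in>?D k. card {x \<in> {1..<i}. f x = x} choose j) = fp_moment R132 (i - 1 - k) j * Q (n - i + k) k" .
    qed simp
    finally show ?thesis .
  qed
  have "fp_moment R132 n (Suc j) = (\<Sum>i\<in>{1..n}. \<Sum>k<i. fp_moment R132 (i - 1 - k) j * Q (n - i + k) k)"
    unfolding fp_moment_Suc using * by simp
  also have "\<dots> = (\<Sum>(i, k)\<in>Sigma {1..n} (\<lambda>i. {..<i}). fp_moment R132 (i - 1 - k) j * Q (n - i + k) k)"
    by (rule sum.Sigma) auto
  \<comment> \<open>Reindex by block size and offset: \<open>i = l + k + 1\<close>, so the outer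
    size \<open>n - i + k\<close> becomes \<open>n - 1 - l\<close>, independent of
    \<open>k\<close>.\<close>
  also have "\<dots> = (\<Sum>(l, k)\<in>Sigma {..<n} (\<lambda>l. {..n - 1 - l}). fp_moment R132 l j * Q (n - 1 - l) k)"
    by (rule sum.reindex_bij_witness[of _ "\<lambda>(l, k). (l + k + 1, k)" "\<lambda>(i, k). (i - 1 - k, k)"]) auto
  also have "\<dots> = (\<Sum>l<n. \<Sum>k\<le>n - 1 - l. fp_moment R132 l j * Q (n - 1 - l) k)"
    by (rule sum.Sigma[symmetric]) auto
  also have "\<dots> = (\<Sum>l<n. fp_moment R132 l j * card (perms_avoiding R132 (n - 1 - l)))"
    unfolding sum_distrib_left[symmetric] Q_def sum_card_corner ..
  finally show ?thesis .
qed

subsection \<open>The moments are ballot numbers\<close>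

text \<open>The reflection-principle form of the ballot numbers; column 0 is the Catalan sequence.
  At \<open>n = 0\<close> and \<open>j > 0\<close> the guard gives 0 where the binomials would give
  1.\<close>

definition ballot :: "nat \<Rightarrow> nat \<Rightarrow> real" where
  "ballot n j = (if j \<le> n then real (2 * n - j choose n) - real (2 * n - j choose Suc n) else 0)"

lemma ballot_0: "ballot 0 j = (if j = 0 then 1 else 0)"
  by (simp add: ballot_def)

text \<open>Pascal's rule in both binomials, regrouped; at \<open>j = n\<close> the first term on
  the right is 0 by the guard.\<close>

lemma ballot_Suc_Suc: "ballot (Suc n) (Suc j) = ballot (Suc n) (Suc (Suc j)) + ballot n j"
proof (cases "j \<le> n")
  case True
  define N where "N = 2 * n - j"
  have "2 * Suc n - Suc j = Suc N" "2 * Suc n - Suc (Suc j) = N" using True by (auto simp: N_def)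
  moreover have "N choose Suc n = 0" "N choose Suc (Suc n) = 0" if "j = n"
    using that by (auto simp: N_def)
  ultimately show ?thesis
    using True by (cases "j = n") (auto simp: ballot_def N_def[symmetric])
qed (simp add: ballot_def)

lemma ballot_Suc_0: "ballot (Suc n) 0 = ballot (Suc n) 1"
proof -
  have "Suc (2 * n) choose n = Suc (2 * n) choose Suc n"
    by (subst binomial_symmetric) auto
  then show ?thesis by (simp add: ballot_def)
qed

text \<open>Each row is determined by the previous one: start from the zeros beyond the diagonal,
  descend in \<open>j\<close> with the recurrence, and read off column 0 from column 1.\<close>

lemma eq_ballotI:
  fixes f :: "nat \<Rightarrow> nat \<Rightarrow> real"
  assumes "f 0 0 = 1" "\<And>n j. n < j \<Longrightarrow> f n j = 0"
    and "\<And>n j. f (Suc n) (Suc j) = f (Suc n) (Suc (Suc j)) + f n j"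
    and "\<And>n. f (Suc n) 0 = f (Suc n) 1"
  shows "f n j = ballot n j"
proof (induction n arbitrary: j)
  case 0
  show ?case using assms(1) assms(2)[of 0 j] by (cases "j = 0") (simp_all add: ballot_0)
next
  case (Suc n)
  have *: "f (Suc n) (Suc i) = ballot (Suc n) (Suc i)" for i
  proof (cases "i \<le> Suc n")
    case True
    then show ?thesis
    proof (induction rule: inc_induct)
      case base
      show ?case using assms(2) by (simp add: ballot_def)
    next
      case (step m)
      then show ?case using Suc.IH[of m] assms(3)[of n m] ballot_Suc_Suc[of n m] by simp
    qed
  qed (use assms(2) in \<open>simp add: ballot_def\<close>)
  show ?case
    using *[of 0] *[of "j - 1"] assms(4) ballot_Suc_0[of n] by (cases j) simp_all
qed

text \<open>With \<open>j = n - t\<close>, partial sums for consecutive thresholds differ by one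
  summand, which is the ballot recurrence.\<close>

lemma count_321_inc_after_eq_ballot:
  assumes "t \<le> n"
  shows "real (count_321_inc_after n t) = ballot n (n - t)"
proof -
  define f where "f n j = (if j \<le> n then real (count_321_inc_after n (n - j)) else 0)" for n j
  have "f n j = ballot n j" for n j
  proof (rule eq_ballotI)
    fix n j
    show "f (Suc n) (Suc j) = f (Suc n) (Suc (Suc j)) + f n j"
    proof (cases "j < n")
      case True
      define p where "p = n - Suc j"
      have "n - j = Suc p" "p \<le> n" "Suc p \<le> n" using True by (auto simp: p_def)
      then show ?thesis
        using True by (simp add: f_def count_321_inc_after_Suc p_def[symmetric])
    qed (auto simp: f_def count_321_inc_after_Suc)
  qed (auto simp: f_def count_321_inc_after_0 count_321_inc_after_Suc_Suc)
  from this[of n "n - t"] show ?thesis using assms by (simp add: f_def)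
qed

text \<open>The hypotheses say that column \<open>j\<close> has generating function
  \<open>x^j C^(j+1)\<close> with \<open>C = 1 + x C^2\<close>. Since
  \<open>C (1 - x C) = 1\<close>, column \<open>j + 1\<close> minus column \<open>j + 2\<close> is
  \<open>x\<close> times column \<open>j\<close>.\<close>

lemma convolution_powers_eq_ballot:
  fixes M :: "nat \<Rightarrow> nat \<Rightarrow> real"
  assumes c0: "M 0 0 = 1" and c: "\<And>n. M (Suc n) 0 = (\<Sum>i<Suc n. M i 0 * M (n - i) 0)"
    and M: "\<And>n j. M n (Suc j) = (\<Sum>l<n. M l j * M (n - 1 - l) 0)"
  shows "M n j = ballot n j"
proof (rule eq_ballotI)
  show "M 0 0 = 1" by (rule c0)
  have M_Suc: "M (Suc n) (Suc j) = (\<Sum>l<Suc n. M l j * M (n - l) 0)" for n j by (simp add: M)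
  show "M n j = 0" if "n < j" for n j
    using that
  proof (induction j arbitrary: n)
    case (Suc j)
    then show ?case by (simp add: M)
  qed simp
  then have M0: "M 0 (Suc j) = 0" for j by simp
  \<comment> \<open>For \<open>j = 0\<close> this is \<open>x C (C - 1)\<close> expanded in
    coefficients; the induction step multiplies the identity by \<open>x C\<close>.\<close>
  have "M (Suc n) (Suc (Suc j)) = M (Suc n) (Suc j) - M n j" for n j
  proof (induction j arbitrary: n)
    case 0
    have "M (Suc n) (Suc (Suc 0)) = (\<Sum>l<n. M (Suc l) (Suc 0) * M (n - Suc l) 0)"
      unfolding M_Suc[of _ "Suc 0"] sum.lessThan_Suc_shift by (simp add: M0)
    also have "\<dots> = (\<Sum>l<n. M (Suc l) 0 * M (n - Suc l) 0)" by (simp only: M_Suc c)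
    also have "\<dots> = (\<Sum>l<Suc n. M l 0 * M (n - l) 0) - M n 0"
      unfolding sum.lessThan_Suc_shift by (simp add: c0)
    finally show ?case by (simp only: M_Suc)
  next
    case (Suc j)
    have "M (Suc n) (Suc (Suc (Suc j))) = (\<Sum>l<n. M (Suc l) (Suc (Suc j)) * M (n - Suc l) 0)"
      unfolding M_Suc[of _ "Suc (Suc j)"] sum.lessThan_Suc_shift by (simp add: M0)
    also have "\<dots> = (\<Sum>l<n. M (Suc l) (Suc j) * M (n - Suc l) 0) - (\<Sum>l<n. M l j * M (n - 1 - l) 0)"
      by (simp add: Suc.IH left_diff_distrib sum_subtractf)
    also have "(\<Sum>l<n. M (Suc l) (Suc j) * M (n - Suc l) 0) = M (Suc n) (Suc (Suc j))"
      unfolding M_Suc[of _ "Suc j"] sum.lessThan_Suc_shift by (simp add: M0)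
    finally show ?case by (simp add: M)
  qed
  then show "M (Suc n) (Suc j) = M (Suc n) (Suc (Suc j)) + M n j" for n j by simp
  show "M (Suc n) 0 = M (Suc n) 1" for n using M_Suc[of n 0] c[of n] by simp
qed

lemma fp_moment_0: "fp_moment R n 0 = card (perms_avoiding R n)"
  by (simp add: fp_moment_def)

lemma fp_moment_R132: "real (fp_moment R132 n j) = ballot n j"
proof (rule convolution_powers_eq_ballot)
  show "real (fp_moment R132 0 0) = 1" by (simp add: fp_moment_0 card_perms_avoiding_0)
  show "real (fp_moment R132 (Suc n) 0) = (\<Sum>i<Suc n. real (fp_moment R132 i 0) * real (fp_moment R132 (n - i) 0))" for n
    by (simp add: fp_moment_0 card_perms_avoiding_R132_Suc lessThan_Suc_atMost del: sum.lessThan_Suc sum.atMost_Suc)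
  show "real (fp_moment R132 n (Suc j)) = (\<Sum>l<n. real (fp_moment R132 l j) * real (fp_moment R132 (n - 1 - l) 0))" for n j
    by (simp add: fp_moment_0 fp_moment_R132_Suc)
qed

text \<open>The recurrences for 321 and 132 have the same form, so it suffices that both patterns
  have equally many avoiders. For 321 that count comes from the increasing-suffix
  refinement.\<close>

lemma fp_moment_R321: "real (fp_moment R321 n j) = ballot n j"
proof -
  have c: "card (perms_avoiding R321 n) = card (perms_avoiding R132 n)" for n
    using count_321_inc_after_eq_ballot[of n n] fp_moment_R132[of n 0] card_perms_avoiding_R321[of n]
    by (simp add: fp_moment_0)
  have "fp_moment R321 n j = fp_moment R132 n j"
  proof (induction j arbitrary: n)
    case 0
    show ?case by (simp add: fp_moment_0 c)
  next
    case (Suc j)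
    have "fp_moment R321 n (Suc j) = (\<Sum>i\<in>{1..n}. fp_moment R132 (i - 1) j * card (perms_avoiding R132 (n - i)))"
      by (simp add: fp_moment_R321_Suc Suc c)
    also have "\<dots> = (\<Sum>l<n. fp_moment R132 l j * card (perms_avoiding R132 (n - 1 - l)))"
      by (rule sum.reindex_bij_witness[of _ Suc "\<lambda>i. i - 1"]) auto
    finally show ?case by (simp add: fp_moment_R132_Suc)
  qed
  then show ?thesis by (simp add: fp_moment_R132)
qed

section \<open>Reverse-complement and the pattern 213\<close>

text \<open>Conjugation by \<open>x -> n + 1 - x\<close> reverses both positions and values. It
  swaps 132 with 213 and moves a fixed point \<open>x\<close> to the fixed point
  \<open>n + 1 - x\<close>.\<close>

lemma fp_moment_R213: "real (fp_moment R213 n j) = ballot n j"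
proof -
  let ?r = "\<lambda>x. Suc n - x"
  have "fp_moment R213 n j = fp_moment R132 n j"
    unfolding fp_moment_def perms_avoiding_def mem_Collect_eq
  proof (rule sum_bijs_transfer[where \<alpha> = ?r and \<beta> = ?r])
    show bij: "bij_betw ?r {1..n} {1..n}" "bij_betw ?r {1..n} {1..n}"
      by (rule bij_betw_byWitness[where f' = ?r]; auto)+
    fix f g assume f: "f \<in> bijs {1..n} {1..n}" and g: "g \<in> bijs {1..n} {1..n}"
      and fg: "\<And>x. x \<in> {1..n} \<Longrightarrow> f (?r x) = ?r (g x)"
    have r: "x \<in> {1..n} \<Longrightarrow> ?r x \<in> {1..n}" "x \<in> {1..n} \<Longrightarrow> ?r (?r x) = x" for x by auto
    have gf: "g (?r x) = ?r (f x)" if "x \<in> {1..n}" for x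
      using fg[OF r(1)[OF that]] bijsD(4)[OF g r(1)[OF that]] r(2)[OF that] by auto
    show "avoids R213 {1..n} f \<longleftrightarrow> avoids R132 {1..n} g"
    proof
      assume av: "avoids R213 {1..n} f"
      show "avoids R132 {1..n} g"
        unfolding avoids_def
      proof (intro ballI impI notI)
        fix x y z assume *: "x \<in> {1..n}" "y \<in> {1..n}" "z \<in> {1..n}" "x < y" "y < z" "R132 (g x) (g y) (g z)"
        then have "R213 (f (?r z)) (f (?r y)) (f (?r x))"
          using fg bijsD(4)[OF g, of x] bijsD(4)[OF g, of y] bijsD(4)[OF g, of z]
          by (auto simp: R132_def R213_def)
        moreover have "?r z < ?r y" "?r y < ?r x" using * by auto
        ultimately show False using av r(1) * unfolding avoids_def by blast
      qed
    next
      assume av: "avoids R132 {1..n} g"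
      show "avoids R213 {1..n} f"
        unfolding avoids_def
      proof (intro ballI impI notI)
        fix x y z assume *: "x \<in> {1..n}" "y \<in> {1..n}" "z \<in> {1..n}" "x < y" "y < z" "R213 (f x) (f y) (f z)"
        then have "R132 (g (?r z)) (g (?r y)) (g (?r x))"
          using gf bijsD(4)[OF f, of x] bijsD(4)[OF f, of y] bijsD(4)[OF f, of z]
          by (auto simp: R132_def R213_def)
        moreover have "?r z < ?r y" "?r y < ?r x" using * by auto
        ultimately show False using av r(1) * unfolding avoids_def by blast
      qed
    qed
    have "bij_betw ?r {x \<in> {1..n}. f x = x} {x \<in> {1..n}. g x = x}"
    proof (rule bij_betw_byWitness[where f' = ?r])
      show "?r ` {x \<in> {1..n}. f x = x} \<subseteq> {x \<in> {1..n}. g x = x}" using gf r(1) by auto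
      show "?r ` {x \<in> {1..n}. g x = x} \<subseteq> {x \<in> {1..n}. f x = x}" using fg r(1) by auto
    qed auto
    then have "fp n f = fp n g" unfolding fp_def by (rule bij_betw_same_card)
    then show "fp n f choose j = fp n g choose j" by simp
  qed
  then show ?thesis by (simp add: fp_moment_R132)
qed

section \<open>Translation to patterns in one-line notation\<close>

lemma contains_pattern_3:
  "contains_pattern n \<sigma> [a, b, c] \<longleftrightarrow>
     (\<exists>i\<in>{1..n}. \<exists>j\<in>{1..n}. \<exists>k\<in>{1..n}. i < j \<and> j < k \<and>
        (\<sigma> i < \<sigma> j \<longleftrightarrow> a < b) \<and> (\<sigma> j < \<sigma> i \<longleftrightarrow> b < a) \<and>
        (\<sigma> i < \<sigma> k \<longleftrightarrow> a < c) \<and> (\<sigma> k < \<sigma> i \<longleftrightarrow> c < a) \<and>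
        (\<sigma> j < \<sigma> k \<longleftrightarrow> b < c) \<and> (\<sigma> k < \<sigma> j \<longleftrightarrow> c < b))" (is "_ \<longleftrightarrow> ?R")
proof -
  have set: "{1..length [a, b, c]} = {1, 2, 3}" by auto
  show ?thesis
  proof
    assume "contains_pattern n \<sigma> [a, b, c]"
    then obtain idx where idx: "strict_mono_on {1, 2, 3} idx" "idx ` {1, 2, 3} \<subseteq> {1..n}"
      "\<forall>j\<in>{1, 2, 3}. \<forall>k\<in>{1, 2, 3}. \<sigma> (idx j) < \<sigma> (idx k) \<longleftrightarrow> [a, b, c] ! (j - 1) < [a, b, c] ! (k - 1)"
      unfolding contains_pattern_def set by blast
    show ?R
    proof (intro bexI conjI)
      show "idx 1 < idx 2" "idx 2 < idx 3" using idx(1) by (auto simp: strict_mono_on_def)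
    qed (use idx(2,3) in \<open>auto simp: numeral_3_eq_3 numeral_2_eq_2\<close>)
  next
    assume ?R
    then obtain i j k where ijk: "i \<in> {1..n}" "j \<in> {1..n}" "k \<in> {1..n}" "i < j" "j < k"
        "\<sigma> i < \<sigma> j \<longleftrightarrow> a < b" "\<sigma> j < \<sigma> i \<longleftrightarrow> b < a" "\<sigma> i < \<sigma> k \<longleftrightarrow> a < c" "\<sigma> k < \<sigma> i \<longleftrightarrow> c < a"
        "\<sigma> j < \<sigma> k \<longleftrightarrow> b < c" "\<sigma> k < \<sigma> j \<longleftrightarrow> c < b"
      by blast
    then show "contains_pattern n \<sigma> [a, b, c]"
      unfolding contains_pattern_def set
      by (intro exI[of _ "\<lambda>t. if t = 1 then i else if t = 2 then j else k"])
         (auto simp: strict_mono_on_def numeral_3_eq_3 numeral_2_eq_2)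
  qed
qed

lemma avoiders_eq_perms_avoiding:
  assumes "\<And>x y z. R x y z \<longleftrightarrow> (x < y \<longleftrightarrow> a < b) \<and> (y < x \<longleftrightarrow> b < a) \<and> (x < z \<longleftrightarrow> a < c) \<and>
      (z < x \<longleftrightarrow> c < a) \<and> (y < z \<longleftrightarrow> b < c) \<and> (z < y \<longleftrightarrow> c < b)"
  shows "avoiders n [a, b, c] = perms_avoiding R n"
  unfolding avoiders_def perms_avoiding_def bijs_eq_permutes contains_pattern_3 avoids_def assms
  by blast

lemma avoiders_132: "avoiders n [1, 3, 2] = perms_avoiding R132 n"
  and avoiders_321: "avoiders n [3, 2, 1] = perms_avoiding R321 n"
  and avoiders_213: "avoiders n [2, 1, 3] = perms_avoiding R213 n"
  by (rule avoiders_eq_perms_avoiding; auto simp: R132_def R321_def R213_def)+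

lemma sum_fp_choose_avoiders:
  assumes "\<tau> \<in> {[1, 3, 2], [3, 2, 1], [2, 1, 3]}"
  shows "(\<Sum>\<sigma>\<in>avoiders n \<tau>. real (fp n \<sigma> choose j)) = ballot n j"
  using assms fp_moment_R132[of n j] fp_moment_R321[of n j] fp_moment_R213[of n j]
  by (auto simp: avoiders_132 avoiders_321 avoiders_213 fp_moment_def simp del: One_nat_def)

subsection \<open>Asymptotics and convergence in distribution\<close>

lemma finite_avoiders [simp]: "finite (avoiders n \<tau>)"
  by (rule finite_subset[of _ "{\<sigma>. \<sigma> permutes {1..n}}"]) (auto simp: avoiders_def finite_permutations)

section \<open>Ratios of ballot numbers to Catalan numbers\<close>

text \<open>Absorption turns the second binomial into \<open>(n - j) / (n + 1)\<close> times the
  first, which leaves the factor \<open>(j + 1) / (n + 1)\<close>.\<close>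

lemma ballot_closed_form:
  assumes "j \<le> n"
  shows "ballot n j = real (Suc j) / real (Suc n) * real (2 * n - j choose n)"
proof -
  define N where "N = 2 * n - j"
  have "Suc n * (N choose Suc n) = (N - n) * (N choose n)"
    using Suc_times_binomial[of n "N - 1"] binomial_absorb_comp[of N n] by (cases N) auto
  then have "real (Suc n) * real (N choose Suc n) = real (N - n) * real (N choose n)"
    by (metis of_nat_mult)
  moreover have "real (N - n) = real n - real j" using assms by (simp add: N_def of_nat_diff)
  ultimately have "real (Suc n) * (real (N choose n) - real (N choose Suc n)) = real (Suc j) * real (N choose n)"
    by (simp add: algebra_simps)
  then show ?thesis using assms by (simp add: ballot_def N_def field_simps)
qed

lemma ballot_0_pos: "0 < ballot n 0"
  by (simp add: ballot_closed_form)

text \<open>Raising \<open>j\<close> by one multiplies the binomial in the closed form by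
  \<open>(n - j) / (2 n - j)\<close>. For \<open>j > n\<close> both sides vanish, because the
  product contains the factor \<open>i = n\<close>.\<close>

lemma ballot_ratio:
  "ballot n j = ballot n 0 * (real (Suc j) * (\<Prod>i<j. (real n - real i) / (2 * real n - real i)))"
proof (induction j)
  case (Suc j)
  show ?case
  proof (cases "j < n")
    case True
    define N where "N = 2 * n - Suc j"
    have N: "2 * n - j = Suc N" using True by (simp add: N_def)
    have "(n - j) * (Suc N choose n) = Suc N * (N choose n)"
      using binomial_absorb_comp[of "Suc N" n] N True by (simp add: N_def)
    then have "real (n - j) * real (Suc N choose n) = real (Suc N) * real (N choose n)"
      by (metis of_nat_mult)
    then have "real (N choose n) = real (n - j) * real (Suc N choose n) / real (Suc N)"
      by (simp only:) simp
    moreover have "real (Suc N) = 2 * real n - real j" using True by (simp add: N[symmetric])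
    ultimately have C: "real (N choose n) = (real n - real j) / (2 * real n - real j) * real (Suc N choose n)"
      using True by simp
    have "ballot n (Suc j) = real (Suc (Suc j)) / real (Suc n) * real (N choose n)"
      using True by (subst ballot_closed_form) (simp_all add: N_def)
    also have "\<dots> = ballot n j / real (Suc j) * real (Suc (Suc j)) * ((real n - real j) / (2 * real n - real j))"
      using True unfolding C by (subst ballot_closed_form) (simp_all add: N)
    finally show ?thesis by (subst (asm) Suc.IH) simp
  next
    case False
    then have "(\<Prod>i<Suc j. (real n - real i) / (2 * real n - real i)) = 0"
      by (intro prod_zero) (auto intro!: bexI[of _ n])
    then show ?thesis using False by (simp add: ballot_def)
  qed
qed simp

lemma tendsto_ballot_ratio: "(\<lambda>n. ballot n j / ballot n 0) \<longlonglongrightarrow> real (Suc j) * (1 / 2) ^ j"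
proof -
  have factor: "(\<lambda>n. (real n - real i) / (2 * real n - real i)) \<longlonglongrightarrow> 1 / 2" for i
  proof -
    have "(\<lambda>n. (1 - real i / real n) / (2 - real i / real n)) \<longlonglongrightarrow> (1 - 0) / (2 - 0)"
      by (intro tendsto_intros lim_const_over_n) simp
    moreover have "\<forall>\<^sub>F n in sequentially. (1 - real i / real n) / (2 - real i / real n) = (real n - real i) / (2 * real n - real i)"
      using eventually_gt_at_top[of "0::nat"]
      by eventually_elim (simp add: diff_divide_eq_iff divide_diff_eq_iff)
    ultimately show ?thesis by (simp add: filterlim_cong)
  qed
  have "(\<lambda>n. real (Suc j) * (\<Prod>i<j. (real n - real i) / (2 * real n - real i))) \<longlonglongrightarrow> real (Suc j) * (\<Prod>i<j. 1 / 2)"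
    by (intro tendsto_intros factor)
  moreover have "ballot n j / ballot n 0 = real (Suc j) * (\<Prod>i<j. (real n - real i) / (2 * real n - real i))" for n
    using ballot_ratio[of n j] ballot_0_pos[of n] by simp
  ultimately show ?thesis by simp
qed

text \<open>Each factor \<open>(n - i) / (2 n - i)\<close> is at most its limit
  \<open>1 / 2\<close>. The bound is uniform in \<open>n\<close> and serves as the dominating
  sequence.\<close>

lemma abs_ballot_ratio_le: "\<bar>ballot n j / ballot n 0\<bar> \<le> real (Suc j) * (1 / 2) ^ j"
proof (cases "j \<le> n")
  case True
  have "(\<Prod>i<j. (real n - real i) / (2 * real n - real i)) \<le> (\<Prod>i<j. 1 / 2)"
    using True by (intro prod_mono) (auto simp: field_simps)
  moreover have "0 \<le> (\<Prod>i<j. (real n - real i) / (2 * real n - real i))"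
    using True by (intro prod_nonneg) auto
  ultimately show ?thesis
    using ballot_ratio[of n j] ballot_0_pos[of n] by (simp add: abs_mult mult_left_mono)
qed (simp add: ballot_def)

text \<open>Tannery's theorem, applied to any linear combination of the moments. The finite sum is a
  full series because ballot numbers vanish for \<open>j > n\<close>.\<close>

lemma tendsto_ballot_series:
  fixes w :: "nat \<Rightarrow> real"
  assumes "summable (\<lambda>j. \<bar>w j\<bar> * (real (Suc j) * (1 / 2) ^ j))"
    and "(\<lambda>j. w j * (real (Suc j) * (1 / 2) ^ j)) sums s"
  shows "(\<lambda>n. (\<Sum>j\<le>n. w j * ballot n j) / ballot n 0) \<longlonglongrightarrow> s"
proof -
  have "(\<lambda>n. \<Sum>j. w j * (ballot n j / ballot n 0)) \<longlonglongrightarrow> (\<Sum>j. w j * (real (Suc j) * (1 / 2) ^ j))"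
  proof (rule tannerys_theorem[THEN conjunct2, THEN conjunct2])
    show "\<forall>\<^sub>F (j, n) in sequentially \<times>\<^sub>F sequentially.
        norm (w j * (ballot n j / ballot n 0)) \<le> \<bar>w j\<bar> * (real (Suc j) * (1 / 2) ^ j)"
      unfolding real_norm_def abs_mult case_prod_unfold
      by (intro always_eventually allI mult_left_mono abs_ballot_ratio_le abs_ge_zero)
    show "(\<lambda>n. w j * (ballot n j / ballot n 0)) \<longlonglongrightarrow> w j * (real (Suc j) * (1 / 2) ^ j)" for j
      by (intro tendsto_mult tendsto_const tendsto_ballot_ratio)
  qed (use assms(1) in simp_all)
  moreover have "(\<Sum>j. w j * (ballot n j / ballot n 0)) = (\<Sum>j\<le>n. w j * ballot n j) / ballot n 0" for n
    by (subst suminf_finite[of "{..n}"]) (auto simp: ballot_def sum_divide_distrib)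
  ultimately show ?thesis using assms(2) by (simp add: sums_iff)
qed

lemma fp_le: "fp n \<sigma> \<le> n"
proof -
  have "fp n \<sigma> \<le> card {1..n}" unfolding fp_def by (rule card_mono) auto
  then show ?thesis by simp
qed

section \<open>From binomial moments to weights and counts\<close>

lemma sum_choose_diff_power:
  fixes q :: real
  assumes "N \<le> n"
  shows "(\<Sum>j\<le>n. (q - 1) ^ j * real (N choose j)) = q ^ N"
proof -
  have "q ^ N = (\<Sum>j\<le>N. real (N choose j) * (q - 1) ^ j)"
    using binomial_ring[of "q - 1" 1 N] by simp
  also have "\<dots> = (\<Sum>j\<le>n. (q - 1) ^ j * real (N choose j))"
    using assms by (intro sum.mono_neutral_cong_left) auto
  finally show ?thesis ..
qed

text \<open>Binomial inversion: the product of binomials equals \<open>N choose k\<close> times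
  \<open>(N - k) choose (j - k)\<close>, and the alternating sum over row \<open>N - k\<close>
  vanishes unless \<open>N = k\<close>.\<close>

lemma sum_alternating_choose_choose:
  assumes "N \<le> n"
  shows "(\<Sum>j\<le>n. (-1) ^ (j + k) * real (j choose k) * real (N choose j)) = (if N = k then 1 else 0)"
proof (cases "k \<le> N")
  case True
  have "(\<Sum>j\<le>n. (-1) ^ (j + k) * real (j choose k) * real (N choose j)) =
      (\<Sum>j\<in>{k..N}. (-1) ^ (j + k) * real (j choose k) * real (N choose j))"
    using assms by (intro sum.mono_neutral_right) auto
  also have "\<dots> = (\<Sum>m\<le>N - k. real (N choose k) * ((-1) ^ m * real (N - k choose m)))"
  proof (rule sum.reindex_bij_witness[of _ "\<lambda>m. m + k" "\<lambda>j. j - k"])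
    fix j assume j: "j \<in> {k..N}"
    then have "(-1 :: real) ^ (j + k) = (-1) ^ (j - k)"
      by (metis (no_types) add_diff_cancel_right' atLeastAtMost_iff even_add even_diff_nat minus_one_power_iff not_less)
    moreover have "real (j choose k) * real (N choose j) = real (N choose k) * real (N - k choose (j - k))"
      using choose_mult[of k j N] j by (metis atLeastAtMost_iff mult.commute of_nat_mult)
    ultimately show "real (N choose k) * ((-1) ^ (j - k) * real (N - k choose (j - k))) =
        (-1) ^ (j + k) * real (j choose k) * real (N choose j)"
      by (simp add: mult_ac)
  qed (use True in auto)
  also have "\<dots> = real (N choose k) * (\<Sum>m\<le>N - k. (-1) ^ m * real (N - k choose m))"
    by (simp add: sum_distrib_left)
  also have "\<dots> = (if N = k then 1 else 0)"
    using choose_alternating_sum[of "N - k", where 'a = real] True by (cases "N = k") auto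
  finally show ?thesis .
next
  case False
  then have "(-1) ^ (j + k) * real (j choose k) * real (N choose j) = 0" for j
    by (cases "j < k") auto
  then have "(\<Sum>j\<le>n. (-1) ^ (j + k) * real (j choose k) * real (N choose j)) = 0"
    by (intro sum.neutral ballI)
  then show ?thesis using False by simp
qed

context
  fixes \<tau> :: "nat list"
  assumes \<tau>: "\<tau> \<in> {[1, 3, 2], [3, 2, 1], [2, 1, 3]}"
begin

lemma Zfun_eq_sum_ballot: "Zfun n q \<tau> = (\<Sum>j\<le>n. (q - 1) ^ j * ballot n j)"
proof -
  have "Zfun n q \<tau> = (\<Sum>\<sigma>\<in>avoiders n \<tau>. \<Sum>j\<le>n. (q - 1) ^ j * real (fp n \<sigma> choose j))"
    unfolding Zfun_def by (simp add: sum_choose_diff_power[OF fp_le])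
  also have "\<dots> = (\<Sum>j\<le>n. (q - 1) ^ j * ballot n j)"
    by (subst sum.swap) (simp add: sum_distrib_left[symmetric] sum_fp_choose_avoiders[OF \<tau>])
  finally show ?thesis .
qed

lemma card_fp_eq_sum_ballot:
  "real (card {\<sigma> \<in> avoiders n \<tau>. fp n \<sigma> = k}) = (\<Sum>j\<le>n. ((-1) ^ (j + k) * real (j choose k)) * ballot n j)"
proof -
  have "real (card {\<sigma> \<in> avoiders n \<tau>. fp n \<sigma> = k}) = (\<Sum>\<sigma>\<in>avoiders n \<tau>. if fp n \<sigma> = k then 1 else 0)"
    by (simp add: sum.If_cases Int_def)
  also have "\<dots> = (\<Sum>\<sigma>\<in>avoiders n \<tau>. \<Sum>j\<le>n. (-1) ^ (j + k) * real (j choose k) * real (fp n \<sigma> choose j))"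
    by (simp only: sum_alternating_choose_choose[OF fp_le])
  also have "\<dots> = (\<Sum>j\<le>n. ((-1) ^ (j + k) * real (j choose k)) * ballot n j)"
    by (subst sum.swap) (simp add: sum_distrib_left[symmetric] sum_fp_choose_avoiders[OF \<tau>])
  finally show ?thesis .
qed

section \<open>Limits of the partition function and of the counts\<close>

text \<open>The limiting series is the sum of \<open>(j + 1) x^j\<close>, namely
  \<open>1 / (1 - x)^2\<close>, at \<open>x = (q - 1) / 2\<close>. The bounds on \<open>q\<close>
  ensure that \<open>x\<close> has modulus below 1.\<close>

lemma tendsto_Zfun:
  assumes "0 < q" "q < 3"
  shows "(\<lambda>n. Zfun n q \<tau> / ballot n 0) \<longlonglongrightarrow> 4 / (3 - q)\<^sup>2"
  unfolding Zfun_eq_sum_ballot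
proof (rule tendsto_ballot_series)
  have sums: "(\<lambda>j. real (Suc j) * x ^ j) sums (1 / (1 - x)\<^sup>2)" if "\<bar>x\<bar> < 1" for x :: real
    using geometric_deriv_sums[of x] that by simp
  show "summable (\<lambda>j. \<bar>(q - 1) ^ j\<bar> * (real (Suc j) * (1 / 2) ^ j))"
    using sums[of "\<bar>q - 1\<bar> / 2"] assms by (simp add: sums_iff power_abs power_divide mult_ac)
  have "1 / (1 - (q - 1) / 2)\<^sup>2 = 4 / (3 - q)\<^sup>2"
    using assms by (simp add: field_simps power2_eq_square)
  then show "(\<lambda>j. (q - 1) ^ j * (real (Suc j) * (1 / 2) ^ j)) sums (4 / (3 - q)\<^sup>2)"
    using sums[of "(q - 1) / 2"] assms by (simp add: power_divide mult_ac)
qed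

text \<open>After the shift \<open>j = m + k\<close> the limiting series is a binomial series with
  exponent \<open>-(k + 2)\<close>: at \<open>x = 1/2\<close> it gives the limit, and at
  \<open>x = -1/2\<close> the absolute summability.\<close>

lemma tendsto_card_fp:
  "(\<lambda>n. real (card {\<sigma> \<in> avoiders n \<tau>. fp n \<sigma> = k}) / ballot n 0) \<longlonglongrightarrow> 4 / 9 * real (Suc k) / 3 ^ k"
  unfolding card_fp_eq_sum_ballot
proof (rule tendsto_ballot_series)
  define a where "a = - real (k + 2)"
  have gchoose: "(-1) ^ m * real (m + k choose k) * real (Suc (m + k)) = real (Suc k) * (a gchoose m)" for m
  proof -
    have "(m + k choose k) * Suc (m + k) = Suc k * (m + k + 1 choose m)"
      using Suc_times_binomial_eq[of "m + k" k] binomial_symmetric[of m "m + k + 1"] by (simp add: mult.commute)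
    then have "real (m + k choose k) * real (Suc (m + k)) = real (Suc k) * real (m + k + 1 choose m)"
      by (metis of_nat_mult)
    moreover have "a gchoose m = (-1) ^ m * real (m + k + 1 choose m)"
      unfolding a_def gbinomial_minus binomial_gbinomial by (simp add: add_ac)
    ultimately show ?thesis by (simp add: mult_ac)
  qed
  \<comment> \<open>Terms with \<open>j < k\<close> vanish. The free factor
    \<open>\<epsilon>\<close> covers both the signed and the absolute series.\<close>
  have shift: "(\<lambda>j. \<epsilon> j * real (j choose k) * (real (Suc j) * (1 / 2) ^ j)) sums s \<longleftrightarrow>
      (\<lambda>m. \<epsilon> (m + k) * real (m + k choose k) * (real (Suc (m + k)) * (1 / 2) ^ (m + k))) sums s" for \<epsilon> :: "nat \<Rightarrow> real" and s
    by (subst sums_zero_iff_shift[symmetric, of k]) auto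
  have binomial_series: "(\<lambda>m. real (Suc k) / 2 ^ k * ((a gchoose m) * x ^ m)) sums (real (Suc k) / 2 ^ k * (1 + x) powr a)"
    if "\<bar>x\<bar> < 1" for x
    by (intro sums_mult gen_binomial_real that)
  have eq: "real (Suc k) / 2 ^ k * ((a gchoose m) * x ^ m) =
      (-1) ^ m * real (m + k choose k) * (real (Suc (m + k)) * x ^ m / 2 ^ k)" for x m
  proof -
    have "(-1) ^ m * real (m + k choose k) * (real (Suc (m + k)) * x ^ m / 2 ^ k) =
        (-1) ^ m * real (m + k choose k) * real (Suc (m + k)) * (x ^ m / 2 ^ k)" by simp
    from this[unfolded gchoose, symmetric] show ?thesis by simp
  qed
  have *: "(\<lambda>m. (-1) ^ m * real (m + k choose k) * (real (Suc (m + k)) * x ^ m / 2 ^ k))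
      sums (real (Suc k) / 2 ^ k * (1 + x) powr a)" if "\<bar>x\<bar> < 1" for x
    using binomial_series[OF that] by (simp only: eq)
  \<comment> \<open>At \<open>x = -1/2\<close> the sign of \<open>x^m\<close> cancels the
    alternating sign.\<close>
  have unsigned: "(-1) ^ m * real (m + k choose k) * (real (Suc (m + k)) * (- 1 / 2) ^ m / 2 ^ k) =
      1 * real (m + k choose k) * (real (Suc (m + k)) * (1 / 2) ^ (m + k))" for m
  proof -
    have "(-1 :: real) ^ m * (- 1 / 2) ^ m = ((-1) * (- 1 / 2)) ^ m" by (rule power_mult_distrib[symmetric])
    also have "(-1) * (- 1 / 2) = (1 / 2 :: real)" by simp
    finally have pow: "(-1 :: real) ^ m * (- 1 / 2) ^ m = (1 / 2) ^ m" .
    have "(-1) ^ m * real (m + k choose k) * (real (Suc (m + k)) * (- 1 / 2) ^ m / 2 ^ k) =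
        real (m + k choose k) * (real (Suc (m + k)) * ((-1) ^ m * (- 1 / 2) ^ m) / 2 ^ k)"
      by (simp only: mult_ac times_divide_eq_right times_divide_eq_left)
    also have "\<dots> = 1 * real (m + k choose k) * (real (Suc (m + k)) * ((1 / 2) ^ m * (1 / 2) ^ k))"
      unfolding pow by (simp add: power_one_over)
    finally show ?thesis by (simp only: power_add)
  qed
  have signed: "(-1) ^ m * real (m + k choose k) * (real (Suc (m + k)) * (1 / 2) ^ m / 2 ^ k) =
      (-1) ^ (m + k + k) * real (m + k choose k) * (real (Suc (m + k)) * (1 / 2) ^ (m + k))" for m
  proof -
    have "(-1 :: real) ^ (m + k + k) = (-1) ^ m" by (simp add: minus_one_power_iff)
    then show ?thesis by (simp add: power_add power_one_over)
  qed
  have "(\<lambda>j. 1 * real (j choose k) * (real (Suc j) * (1 / 2) ^ j)) sums (real (Suc k) / 2 ^ k * (1 + - 1 / 2) powr a)"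
    unfolding shift unsigned[symmetric] by (rule *) simp
  then show "summable (\<lambda>j. \<bar>(-1) ^ (j + k) * real (j choose k)\<bar> * (real (Suc j) * (1 / 2) ^ j))"
    by (simp add: sums_iff abs_mult power_abs)
  have "real (Suc k) / 2 ^ k * (1 + 1 / 2) powr a = 4 / 9 * real (Suc k) / 3 ^ k"
  proof -
    have "(3 / 2 :: real) powr a = inverse ((3 / 2) ^ (k + 2))"
      unfolding a_def powr_minus by (subst powr_realpow) simp_all
    also have "\<dots> = 4 / 9 * 2 ^ k / 3 ^ k" by (simp add: power_divide)
    finally show ?thesis by simp
  qed
  then show "(\<lambda>j. (-1) ^ (j + k) * real (j choose k) * (real (Suc j) * (1 / 2) ^ j)) sums (4 / 9 * real (Suc k) / 3 ^ k)"
    unfolding shift signed[symmetric] using *[of "1 / 2"] by simp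
qed

lemma Zfun_pos:
  assumes "0 < q"
  shows "0 < Zfun n q \<tau>"
proof -
  have "ballot n 0 = real (card (avoiders n \<tau>))"
    using sum_fp_choose_avoiders[OF \<tau>, of n 0] by simp
  then have "avoiders n \<tau> \<noteq> {}" using ballot_0_pos[of n] by (auto simp del: One_nat_def)
  then show ?thesis unfolding Zfun_def using assms by (intro sum_pos) auto
qed

lemma pmf_fp:
  assumes "0 < q"
  shows "pmf (map_pmf (fp n) (Pnq n q \<tau>)) k = q ^ k * real (card {\<sigma> \<in> avoiders n \<tau>. fp n \<sigma> = k}) / Zfun n q \<tau>"
proof -
  let ?A = "avoiders n \<tau>"
  let ?f = "\<lambda>\<sigma>. if \<sigma> \<in> ?A then q ^ fp n \<sigma> / Zfun n q \<tau> else 0"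
  note Z = Zfun_pos[OF assms, of n]
  \<comment> \<open>The weights must have total mass 1 before point probabilities of
    \<open>embed_pmf\<close> can be read off.\<close>
  have "(\<integral>\<^sup>+\<sigma>. ennreal (?f \<sigma>) \<partial>count_space UNIV) = (\<Sum>\<sigma>\<in>?A. ennreal (?f \<sigma>))"
    by (rule nn_integral_count_space') auto
  also have "\<dots> = ennreal (\<Sum>\<sigma>\<in>?A. ?f \<sigma>)"
    using Z assms by (intro sum_ennreal) auto
  also have "(\<Sum>\<sigma>\<in>?A. ?f \<sigma>) = 1"
    using Z by (simp add: Zfun_def sum_divide_distrib[symmetric])
  finally have "pmf (Pnq n q \<tau>) \<sigma> = ?f \<sigma>" for \<sigma>
    unfolding Pnq_def using Z assms by (intro pmf_embed_pmf) auto
  note pmf = this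
  then have "set_pmf (Pnq n q \<tau>) \<subseteq> ?A" by (auto simp: set_pmf_eq split: if_splits)
  then have "pmf (map_pmf (fp n) (Pnq n q \<tau>)) k = measure_pmf.prob (Pnq n q \<tau>) {\<sigma> \<in> ?A. fp n \<sigma> = k}"
    unfolding pmf_map by (intro measure_pmf.finite_measure_eq_AE) (auto simp: AE_measure_pmf_iff)
  also have "\<dots> = (\<Sum>\<sigma> | \<sigma> \<in> ?A \<and> fp n \<sigma> = k. ?f \<sigma>)"
    by (simp add: measure_measure_pmf_finite pmf)
  also have "\<dots> = q ^ k * real (card {\<sigma> \<in> ?A. fp n \<sigma> = k}) / Zfun n q \<tau>" by simp
  finally show ?thesis .
qed

end

section \<open>From point probabilities to weak convergence\<close>

lemma pmf_negbin_2:
  assumes "0 < q" "q < 3"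
  shows "pmf (negbin_pmf 2 (1 - q / 3)) k = real (Suc k) * (q / 3) ^ k * (1 - q / 3)\<^sup>2"
proof -
  let ?f = "\<lambda>k. real (Suc k) * (q / 3) ^ k * (1 - q / 3)\<^sup>2"
  have "(\<lambda>k. real (Suc k) * (q / 3) ^ k) sums (1 / (1 - q / 3)\<^sup>2)"
    using geometric_deriv_sums[of "q / 3"] assms by simp
  from sums_mult2[OF this, of "(1 - q / 3)\<^sup>2"] have sums: "?f sums 1" using assms by simp
  have eq: "(\<lambda>k. real (k + 2 - 1 choose k) * (1 - (1 - q / 3)) ^ k * (1 - q / 3)\<^sup>2) = ?f" by simp
  have "(\<integral>\<^sup>+k. ennreal (?f k) \<partial>count_space UNIV) = (\<Sum>k. ennreal (?f k))"
    by (rule nn_integral_count_space_nat)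
  also have "\<dots> = ennreal 1"
    using sums assms by (subst suminf_ennreal2) (auto simp: sums_iff)
  finally show ?thesis
    unfolding negbin_pmf_def eq using assms by (subst pmf_embed_pmf) auto
qed

text \<open>On the naturals a distribution function is a finite sum of point probabilities at every
  argument, so it converges everywhere and not just at continuity points.\<close>

lemma weak_conv_m_map_pmf_real:
  fixes P :: "nat \<Rightarrow> nat pmf"
  assumes "\<And>k. (\<lambda>n. pmf (P n) k) \<longlonglongrightarrow> pmf Q k"
  shows "weak_conv_m (\<lambda>n. measure_pmf (map_pmf real (P n))) (measure_pmf (map_pmf real Q))"
proof -
  have "cdf (measure_pmf (map_pmf real p)) x = (\<Sum>k | real k \<le> x. pmf p k)" for p :: "nat pmf" and x
  proof -
    have "finite {k. real k \<le> x}"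
      by (rule finite_subset[of _ "{..nat \<lceil>x\<rceil>}"]) (auto, linarith)
    then show ?thesis by (simp add: cdf_def vimage_def measure_measure_pmf_finite)
  qed
  then show ?thesis
    unfolding weak_conv_m_def weak_conv_def using assms by (auto intro!: tendsto_sum)
qed

theorem theorem3:
  fixes q :: real and \<tau> :: "nat list"
  assumes "0 < q" and "q < 3"
    and "\<tau> \<in> {[1,3,2], [3,2,1], [2,1,3]}"
  shows "weak_conv_m
           (\<lambda>n. measure_pmf (map_pmf (\<lambda>\<sigma>. real (fp n \<sigma>)) (Pnq n q \<tau>)))
           (measure_pmf (map_pmf real (negbin_pmf 2 (1 - q / 3))))"
proof -
  have "(\<lambda>n. pmf (map_pmf (fp n) (Pnq n q \<tau>)) k) \<longlonglongrightarrow> pmf (negbin_pmf 2 (1 - q / 3)) k" for k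
  proof -
    let ?N = "\<lambda>n. real (card {\<sigma> \<in> avoiders n \<tau>. fp n \<sigma> = k})"
    \<comment> \<open>Dividing both the weighted count and \<open>Zfun\<close> by the Catalan number
      \<open>ballot n 0\<close> gives them finite limits, the second of them nonzero.\<close>
    have eq: "pmf (map_pmf (fp n) (Pnq n q \<tau>)) k = q ^ k * (?N n / ballot n 0) / (Zfun n q \<tau> / ballot n 0)" for n
      using ballot_0_pos[of n] by (simp add: pmf_fp[OF assms(3,1)])
    have "(\<lambda>n. q ^ k * (?N n / ballot n 0) / (Zfun n q \<tau> / ballot n 0)) \<longlonglongrightarrow>
        q ^ k * (4 / 9 * real (Suc k) / 3 ^ k) / (4 / (3 - q)\<^sup>2)"
      using assms(1,2) by (intro tendsto_intros tendsto_card_fp[OF assms(3)] tendsto_Zfun[OF assms(3,1,2)]) auto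
    also have "q ^ k * (4 / 9 * real (Suc k) / 3 ^ k) / (4 / (3 - q)\<^sup>2) = pmf (negbin_pmf 2 (1 - q / 3)) k"
      unfolding pmf_negbin_2[OF assms(1,2)] by (simp add: power_divide power2_eq_square field_simps)
    finally show ?thesis by (simp only: eq)
  qed
  then have "weak_conv_m (\<lambda>n. measure_pmf (map_pmf real (map_pmf (fp n) (Pnq n q \<tau>))))
      (measure_pmf (map_pmf real (negbin_pmf 2 (1 - q / 3))))"
    by (rule weak_conv_m_map_pmf_real)
  then show ?thesis by (simp add: map_pmf_comp)
qed

end
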